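(* For integers $n\ge3$ and $1\le k\le\lceil n/3\rceil$ let $$\boldsymbol{\alpha}(n,k)=\left(\tfrac1n\tfrac\pi2,\tfrac2n\tfrac\pi2,\tfrac3n\tfrac\pi2,\ldots,\tfrac{n-k-1}{n}\tfrac\pi2\right),\qquad \gamma_1(n,k)=\tfrac{n-k}{n}\tfrac\pi2,\qquad \gamma_2(n,k)=\tfrac{n-k+1}{n}\tfrac\pi2,$$ and let $$W_n=\max_{k=1,\ldots,\lceil n/3\rceil}G_{\boldsymbol{\alpha}(n,k)}^{\gamma_1(n,k),\gamma_2(n,k)}.$$ Then $\lim_{n\to\infty}W_n=\mu_{\mathrm{MS}}$.
   Context: Let $H=\mathbb{R}\times[0,1]$. For $\alpha\in[0,\pi/2]$ and $\mathbf{u}=(u_1,u_2)\in\mathbb{R}^2$ let $$L_\alpha(\mathbf{u})=\{(x,y): u_1\le x\cos\alpha+y\sin\alpha\le u_1+1,\ -x\sin\alpha+y\cos\alpha\le u_2+1\}\cup\{(x,y): x\cos\alpha+y\sin\alpha\le u_1+1,\ u_2\le -x\sin\alpha+y\cos\alpha\le u_2+1\}.$$ For angles $\beta_1,\beta_2$ let $$B(\beta_1,\beta_2)=\{(x,y): 0\le x\cos\beta_1+y\sin\beta_1,\ x\cos\beta_2+y\sin\beta_2\le 1\}\cup\{(x,y): x\cos\beta_1+y\sin\beta_1\le 1,\ 0\le x\cos\beta_2+y\sin\beta_2\}.$$ Let $\lambda^*(X)$ be the maximal area of a connected component of $X\subset\mathbb{R}^2$. For $\boldsymbol{\alpha}=(\alpha_1,\ldots,\alpha_m)$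 with $0<\alpha_1<\cdots<\alpha_m<\pi/2$ and $\beta_1,\beta_2\in(\alpha_m,\pi/2]$ with $\beta_1\le\beta_2$, define $$G_{\boldsymbol{\alpha}}^{\beta_1,\beta_2}=\sup_{\mathbf{u}_1,\ldots,\mathbf{u}_m\in\mathbb{R}^2}\lambda^*\Big(H\cap\bigcap_{j=1}^m L_{\alpha_j}(\mathbf{u}_j)\cap B(\beta_1,\beta_2)\Big).$$ Let $L_{\mathrm{horiz}}=(-\infty,1]\times[0,1]$, $L_{\mathrm{vert}}=[0,1]\times(-\infty,1]$, $L_0=L_{\mathrm{horiz}}\cup L_{\mathrm{vert}}$, and let $\mathrm{Rot}_\theta$ be the counterclockwise rotation of $\mathbb{R}^2$ by angle $\theta$ about the origin (so $L_\alpha(\mathbf{u})=\mathrm{Rot}_\alpha(L_0+\mathbf{u})$). The moving sofa constant $\mu_{\mathrm{MS}}$ is the maximal area of a moving sofa shape, i.e. of a nonempty compact connected $S\subset\mathbb{R}^2$ for which there are continuous $\theta:[0,1]\to\mathbb{R}$, $c:[0,1]\to\mathbb{R}^2$ such that $\varphi_t(p)=\mathrm{Rot}_{\theta(t)}(p)+c(t)$ satisfies $\varphi_t(S)\subset L_0$ for all $t\in[0,1]$, $\varphi_0(S)\subset L_{\mathrm{horiz}}$, $\varphi_1(S)\subset L_{\mathrm{vert}}$. By a known theorem of Gerver the maximum exists and $$\mu_{\mathrm{MS}}=\sup\Big\{\lambda^*\Big(L_{\mathrm{horiz}}\cap\bigcap_{0\le t\le\beta}L_t(\mathbf{x}(t))\cap\mathrm{Rot}_\beta\big(\mathbf{x}(\beta)+L_{\mathrm{vert}}\big)\Big)\Big\},$$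 the supremum being over all $\beta\in[0,\pi/2]$ and all continuous $\mathbf{x}:[0,\beta]\to\mathbb{R}^2$ with $\mathbf{x}(0)=(0,0)$. *)

theory Defs
  imports "HOL-Analysis.Analysis"
begin

text \<open>
  Areas are values in \<^typ>\<open>ennreal\<close>, so that every supremum below is meaningful without side
  conditions; in particular the supremum over the components of the empty set is 0.
\<close>

definition horiz_strip :: "(real \<times> real) set" where
  "horiz_strip = UNIV \<times> {0..1}"

definition rot :: "real \<Rightarrow> real \<times> real \<Rightarrow> real \<times> real" where
  "rot \<theta> = (\<lambda>(x, y). (x * cos \<theta> - y * sin \<theta>, x * sin \<theta> + y * cos \<theta>))"

definition L_horiz :: "(real \<times> real) set" where
  "L_horiz = {..1} \<times> {0..1}"

definition L_vert :: "(real \<times> real) set" where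
  "L_vert = {0..1} \<times> {..1}"

definition L_zero :: "(real \<times> real) set" where
  "L_zero = L_horiz \<union> L_vert"

definition hallway :: "real \<Rightarrow> real \<times> real \<Rightarrow> (real \<times> real) set" where
  "hallway \<alpha> u =
     {(x, y). fst u \<le> x * cos \<alpha> + y * sin \<alpha> \<and> x * cos \<alpha> + y * sin \<alpha> \<le> fst u + 1 \<and>
              - x * sin \<alpha> + y * cos \<alpha> \<le> snd u + 1} \<union>
     {(x, y). x * cos \<alpha> + y * sin \<alpha> \<le> fst u + 1 \<and>
              snd u \<le> - x * sin \<alpha> + y * cos \<alpha> \<and> - x * sin \<alpha> + y * cos \<alpha> \<le> snd u + 1}"

lemma hallway_eq_rot: "hallway \<alpha> u = rot \<alpha> ` ((+) u ` L_zero)"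
proof (intro set_eqI iffI)
  fix p assume p: "p \<in> hallway \<alpha> u"
  obtain x y where xy: "p = (x, y)" by (cases p)
  define q where "q = (x * cos \<alpha> + y * sin \<alpha> - fst u, - x * sin \<alpha> + y * cos \<alpha> - snd u)"
  have "q \<in> L_zero"
    using p unfolding xy q_def hallway_def L_zero_def L_horiz_def L_vert_def by auto
  moreover have "rot \<alpha> (u + q) = p"
  proof -
    have "(x * cos \<alpha> + y * sin \<alpha>) * cos \<alpha> - (- x * sin \<alpha> + y * cos \<alpha>) * sin \<alpha> =
          x * ((sin \<alpha>)\<^sup>2 + (cos \<alpha>)\<^sup>2)"
      by algebra
    moreover have "(x * cos \<alpha> + y * sin \<alpha>) * sin \<alpha> + (- x * sin \<alpha> + y * cos \<alpha>) * cos \<alpha> =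
          y * ((sin \<alpha>)\<^sup>2 + (cos \<alpha>)\<^sup>2)"
      by algebra
    ultimately show ?thesis
      by (cases u) (simp add: rot_def q_def xy)
  qed
  ultimately show "p \<in> rot \<alpha> ` ((+) u ` L_zero)" by blast
next
  fix p assume "p \<in> rot \<alpha> ` ((+) u ` L_zero)"
  then obtain q where q: "q \<in> L_zero" "p = rot \<alpha> (u + q)" by blast
  obtain a b where ab: "u + q = (a, b)" by (cases "u + q")
  have p: "p = (a * cos \<alpha> - b * sin \<alpha>, a * sin \<alpha> + b * cos \<alpha>)"
    using q(2) ab by (simp add: rot_def)
  have "(a * cos \<alpha> - b * sin \<alpha>) * cos \<alpha> + (a * sin \<alpha> + b * cos \<alpha>) * sin \<alpha> =
        a * ((sin \<alpha>)\<^sup>2 + (cos \<alpha>)\<^sup>2)"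
    by algebra
  then have 1: "(a * cos \<alpha> - b * sin \<alpha>) * cos \<alpha> + (a * sin \<alpha> + b * cos \<alpha>) * sin \<alpha> = a"
    by simp
  have "- (a * cos \<alpha> - b * sin \<alpha>) * sin \<alpha> + (a * sin \<alpha> + b * cos \<alpha>) * cos \<alpha> =
        b * ((sin \<alpha>)\<^sup>2 + (cos \<alpha>)\<^sup>2)"
    by algebra
  then have 2: "- (a * cos \<alpha> - b * sin \<alpha>) * sin \<alpha> + (a * sin \<alpha> + b * cos \<alpha>) * cos \<alpha> = b"
    by simp
  have "q = (a - fst u, b - snd u)"
    using ab by (cases u; cases q) auto
  then show "p \<in> hallway \<alpha> u"
    using q(1) unfolding p hallway_def L_zero_def L_horiz_def L_vert_def mem_Collect_eq Un_iff
      case_prod_conv 1 2 by auto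
qed

definition butterfly :: "real \<Rightarrow> real \<Rightarrow> (real \<times> real) set" where
  "butterfly \<beta>\<^sub>1 \<beta>\<^sub>2 =
     {(x, y). 0 \<le> x * cos \<beta>\<^sub>1 + y * sin \<beta>\<^sub>1 \<and> x * cos \<beta>\<^sub>2 + y * sin \<beta>\<^sub>2 \<le> 1} \<union>
     {(x, y). x * cos \<beta>\<^sub>1 + y * sin \<beta>\<^sub>1 \<le> 1 \<and> 0 \<le> x * cos \<beta>\<^sub>2 + y * sin \<beta>\<^sub>2}"

definition lambda_star :: "(real \<times> real) set \<Rightarrow> ennreal" where
  "lambda_star X = (SUP C\<in>components X. emeasure lebesgue C)"

text \<open>
  The angle vector is a list indexed from 0. Only the values of \<open>u\<close> at indices below the length
  of this list matter.
\<close>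

definition G_sup :: "real list \<Rightarrow> real \<Rightarrow> real \<Rightarrow> ennreal" where
  "G_sup \<alpha>s \<beta>\<^sub>1 \<beta>\<^sub>2 =
     (SUP u :: nat \<Rightarrow> real \<times> real.
        lambda_star (horiz_strip \<inter> (\<Inter>j<length \<alpha>s. hallway (\<alpha>s ! j) (u j)) \<inter> butterfly \<beta>\<^sub>1 \<beta>\<^sub>2))"

definition angles :: "nat \<Rightarrow> nat \<Rightarrow> real list" where
  "angles n k = map (\<lambda>j. real j / real n * (pi / 2)) [1..<n - k]"

definition gamma1 :: "nat \<Rightarrow> nat \<Rightarrow> real" where
  "gamma1 n k = (real n - real k) / real n * (pi / 2)"

definition gamma2 :: "nat \<Rightarrow> nat \<Rightarrow> real" where
  "gamma2 n k = (real n - real k + 1) / real n * (pi / 2)"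

text \<open>Intended for \<open>n \<ge> 3\<close>, where the index set of the maximum is nonempty and all lists
  \<open>angles n k\<close> are nonempty.\<close>

definition W :: "nat \<Rightarrow> ennreal" where
  "W n = Max ((\<lambda>k. G_sup (angles n k) (gamma1 n k) (gamma2 n k)) ` {1..nat \<lceil>real n / 3\<rceil>})"

definition moving_sofa :: "(real \<times> real) set \<Rightarrow> bool" where
  "moving_sofa S \<longleftrightarrow> S \<noteq> {} \<and> compact S \<and> connected S \<and>
     (\<exists>(\<theta> :: real \<Rightarrow> real) (c :: real \<Rightarrow> real \<times> real).
        continuous_on {0..1} \<theta> \<and> continuous_on {0..1} c \<and>
        (\<forall>t\<in>{0..1}. (\<lambda>p. rot (\<theta> t) p + c t) ` S \<subseteq> L_zero) \<and>
        (\<lambda>p. rot (\<theta> 0) p + c 0) ` S \<subseteq> L_horiz \<and>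
        (\<lambda>p. rot (\<theta> 1) p + c 1) ` S \<subseteq> L_vert)"

definition mu_MS :: ennreal where
  "mu_MS = (SUP S\<in>{S. moving_sofa S}. emeasure lebesgue S)"

end

theory Submission
  imports Defs "HOL-Complex_Analysis.Great_Picard"
begin

text \<open>
  Write \<open>dir \<alpha>\<close> for the unit vector of angle \<open>\<alpha>\<close>. A compact set \<open>S\<close> lies in some
  hallway of angle \<open>\<alpha>\<close> iff it contains no points \<open>p\<close>, \<open>q\<close>, \<open>r\<close> such that \<open>q\<close> exceeds \<open>p\<close> by
  more than 1 in direction \<open>dir \<alpha>\<close> and \<open>r\<close> exceeds \<open>p\<close> by more than 1 in the orthogonal
  direction: the outer walls have to stay beyond \<open>q\<close> and \<open>r\<close>, and then the inner corner cuts
  \<open>p\<close> off. This condition, \<open>fits \<alpha> S\<close>, mentions neither the position of the hallway nor that of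
  \<open>S\<close>. When it holds, the hallway may be pushed against \<open>S\<close> until both outer walls touch; its corner
  is then given by the support function of \<open>S\<close> and so depends continuously on \<open>\<alpha>\<close>. Hence a compact
  connected set in the horizontal strip that fits at every angle of \<open>[0, \<beta>]\<close> and has
  width at most 1 in direction \<open>dir \<beta>\<close> is a moving sofa (\<open>moving_sofa_if_fits\<close>): the
  motion comes for free.

  The sofa constant is a lower bound of every \<open>W n\<close> with \<open>n \<ge> 3\<close> (\<open>mu_MS_le_W\<close>). In the
  coordinates of its first position, a sofa fits at every angle between 0 and its total turn
  \<open>\<beta>\<close>, by the intermediate value theorem. If \<open>\<beta> > \<pi>/3\<close>, then some \<open>k\<close> in the range of the
  maximum has \<open>\<gamma>\<^sub>1 \<le> \<beta> \<le> \<gamma>\<^sub>2\<close> (for \<open>\<beta> \<ge> \<pi>/2\<close> take \<open>k = 1\<close>), and a horizontal translate of the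
  sofa lies in one of the regions that define \<open>G\<close> for this \<open>k\<close>. If \<open>\<beta> \<le> \<pi>/3\<close>, negative values
  included, then all horizontal slices have length at most 2, so the area is at most 2; but
  \<open>W n \<ge> 2\<close>, because a part of Hammersley's sofa with area at least 2 fits at every angle of
  \<open>[0, \<pi>/2]\<close>.

  Conversely, suppose that \<open>c < W n\<close> for infinitely many \<open>n\<close>. This gives components of
  area more than \<open>c\<close> of regions with finer and finer angles. A hallway whose angle is near 45 degrees
  bounds their diameter, so that after horizontal translations a subsequence converges
  in the Hausdorff sense to a compact connected set \<open>S\<close> (\<open>Blaschke_selection\<close>). Area is upper
  semicontinuous under such limits, so \<open>S\<close> has area at least \<open>c\<close>. It fits at every
  angle up to the limit \<open>\<beta>\<close> of \<open>\<gamma>\<^sub>1\<close>, because a forbidden triple is an open condition on the points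
  and the angle, and the butterflies shrink to a strip of width 1 in direction \<open>dir \<beta>\<close>. So
  \<open>S\<close> is a sofa and \<open>c \<le> \<mu>\<close> (\<open>le_mu_MS_if_components\<close>).
\<close>

section \<open>Hallways as a condition on triples of points\<close>

definition dir :: "real \<Rightarrow> real \<times> real" where
  "dir \<alpha> = (cos \<alpha>, sin \<alpha>)"

lemma dir_inner: "dir \<alpha> \<bullet> p = fst p * cos \<alpha> + snd p * sin \<alpha>"
  by (simp add: dir_def inner_prod_def)

lemma dir_quarter_inner: "dir (\<alpha> + pi / 2) \<bullet> p = - fst p * sin \<alpha> + snd p * cos \<alpha>"
  by (simp add: dir_inner cos_add sin_add)

lemma norm_dir [simp]: "norm (dir \<alpha>) = 1"
  by (simp add: dir_def norm_Pair)

lemma continuous_on_dir [continuous_intros]: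
  fixes f :: "'a::t2_space \<Rightarrow> real"
  shows "continuous_on X f \<Longrightarrow> continuous_on X (\<lambda>x. dir (f x))"
  by (auto simp: dir_def intro!: continuous_intros)

lemma tendsto_dir [tendsto_intros]:
  fixes f :: "'a::t2_space \<Rightarrow> real"
  shows "(f \<longlongrightarrow> a) F \<Longrightarrow> ((\<lambda>x. dir (f x)) \<longlongrightarrow> dir a) F"
  by (auto simp: dir_def intro!: tendsto_intros)

lemma rot_uminus_eq: "rot (- \<alpha>) p = (dir \<alpha> \<bullet> p, dir (\<alpha> + pi / 2) \<bullet> p)"
  by (simp add: dir_quarter_inner rot_def case_prod_unfold) (simp add: dir_inner)

lemma hallway_iff:
  "p \<in> hallway \<alpha> u \<longleftrightarrow>
     dir \<alpha> \<bullet> p \<le> fst u + 1 \<and> dir (\<alpha> + pi / 2) \<bullet> p \<le> snd u + 1 \<and>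
     (fst u \<le> dir \<alpha> \<bullet> p \<or> snd u \<le> dir (\<alpha> + pi / 2) \<bullet> p)"
  unfolding dir_quarter_inner by (cases p) (auto simp: hallway_def dir_inner)

text \<open>
  No forbidden triple: for compact \<open>S\<close> this says that some hallway of angle \<open>\<alpha>\<close> contains \<open>S\<close>.
\<close>

definition fits :: "real \<Rightarrow> (real \<times> real) set \<Rightarrow> bool" where
  "fits \<alpha> S \<longleftrightarrow>
     (\<forall>p\<in>S. \<forall>q\<in>S. \<forall>r\<in>S. dir \<alpha> \<bullet> (q - p) \<le> 1 \<or> dir (\<alpha> + pi / 2) \<bullet> (r - p) \<le> 1)"

lemma fits_if_subset_hallway:
  assumes "S \<subseteq> hallway \<alpha> u"
  shows "fits \<alpha> S"
  unfolding fits_def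
proof (intro ballI)
  fix p q r assume "p \<in> S" "q \<in> S" "r \<in> S"
  then have "p \<in> hallway \<alpha> u" "q \<in> hallway \<alpha> u" "r \<in> hallway \<alpha> u"
    using assms by auto
  then show "dir \<alpha> \<bullet> (q - p) \<le> 1 \<or> dir (\<alpha> + pi / 2) \<bullet> (r - p) \<le> 1"
    unfolding hallway_iff inner_diff_right by linarith
qed

lemma fits_translation: "fits \<alpha> ((+) v ` S) \<longleftrightarrow> fits \<alpha> S"
  by (simp add: fits_def)

text \<open>
  The support function, which measures how far the set reaches in a given direction.
\<close>

definition supp :: "(real \<times> real) set \<Rightarrow> real \<times> real \<Rightarrow> real" where
  "supp S v = (SUP p\<in>S. v \<bullet> p)"

lemma bdd_above_inner_image:
  fixes S :: "(real \<times> real) set"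
  assumes "bounded S"
  shows "bdd_above ((\<bullet>) v ` S)"
proof -
  obtain M where M: "\<And>p. p \<in> S \<Longrightarrow> norm p \<le> M"
    using assms bounded_iff by blast
  have "v \<bullet> p \<le> norm v * M" if "p \<in> S" for p
    using M[OF that] norm_cauchy_schwarz[of v p] mult_left_mono[of "norm p" M "norm v"] by force
  then show ?thesis by (intro bdd_aboveI) auto
qed

lemma supp_upper: "bounded S \<Longrightarrow> p \<in> S \<Longrightarrow> v \<bullet> p \<le> supp S v"
  unfolding supp_def by (intro cSUP_upper bdd_above_inner_image)

lemma supp_least: "S \<noteq> {} \<Longrightarrow> (\<And>p. p \<in> S \<Longrightarrow> v \<bullet> p \<le> c) \<Longrightarrow> supp S v \<le> c"
  unfolding supp_def by (intro cSUP_least)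

lemma supp_attained:
  assumes "compact S" "S \<noteq> {}"
  obtains p where "p \<in> S" "v \<bullet> p = supp S v"
proof -
  obtain p where p: "p \<in> S" "\<And>q. q \<in> S \<Longrightarrow> v \<bullet> q \<le> v \<bullet> p"
    using continuous_attains_sup[OF assms, of "\<lambda>q. v \<bullet> q"] continuous_on_inner[OF continuous_on_const continuous_on_id]
    by blast
  then have "supp S v = v \<bullet> p"
    using assms by (intro antisym supp_least supp_upper) (auto simp: compact_imp_bounded)
  then show thesis using p that by auto
qed

text \<open>
  A support function is Lipschitz: the radius of a ball about the origin that contains the set is
  a constant for it.
\<close>

lemma continuous_on_supp:
  assumes "bounded S" "S \<noteq> {}"
  shows "continuous_on X (supp S)"
proof -
  obtain M where M: "\<And>p. p \<in> S \<Longrightarrow> norm p \<le> M"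
    using assms bounded_iff by blast
  have M0: "M \<ge> 0" using assms(2) M norm_ge_zero order_trans by blast
  have le: "supp S v \<le> supp S w + M * norm (v - w)" for v w
  proof (rule supp_least[OF assms(2)])
    fix p assume p: "p \<in> S"
    have "v \<bullet> p = w \<bullet> p + (v - w) \<bullet> p" by (simp add: inner_diff_left)
    also have "(v - w) \<bullet> p \<le> norm (v - w) * norm p" by (rule norm_cauchy_schwarz)
    also have "\<dots> \<le> norm (v - w) * M" using M[OF p] by (simp add: mult_left_mono)
    finally show "v \<bullet> p \<le> supp S w + M * norm (v - w)"
      using supp_upper[OF assms(1) p, of w] by (simp add: mult.commute)
  qed
  have "\<bar>supp S v - supp S w\<bar> \<le> M * norm (v - w)" for v w
    using le[of v w] le[of w v] by (simp add: norm_minus_commute)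
  then have "M-lipschitz_on X (supp S)"
    using M0 by (intro lipschitz_onI) (auto simp: dist_norm)
  then show ?thesis by (rule lipschitz_on_continuous_on)
qed

text \<open>
  Coordinates of the inner corner, in the frame of the hallway, when both outer walls touch the set.
\<close>

definition tight_corner :: "(real \<times> real) set \<Rightarrow> real \<Rightarrow> real \<times> real" where
  "tight_corner S \<alpha> = (supp S (dir \<alpha>) - 1, supp S (dir (\<alpha> + pi / 2)) - 1)"

text \<open>
  The suprema in the tight corner are attained at some \<open>q\<close> and \<open>r\<close>, so a point cut off by the
  inner corner would form a forbidden triple with them.
\<close>

lemma fits_imp_subset_hallway:
  assumes "compact S" "fits \<alpha> S"
  shows "S \<subseteq> hallway \<alpha> (tight_corner S \<alpha>)"
proof
  fix p assume p: "p \<in> S"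
  then have ne: "S \<noteq> {}" by auto
  obtain q where q: "q \<in> S" "dir \<alpha> \<bullet> q = supp S (dir \<alpha>)"
    using supp_attained[OF assms(1) ne] .
  obtain r where r: "r \<in> S" "dir (\<alpha> + pi / 2) \<bullet> r = supp S (dir (\<alpha> + pi / 2))"
    using supp_attained[OF assms(1) ne] .
  have "dir \<alpha> \<bullet> (q - p) \<le> 1 \<or> dir (\<alpha> + pi / 2) \<bullet> (r - p) \<le> 1"
    using assms(2) p q r unfolding fits_def by blast
  moreover have "dir \<alpha> \<bullet> p \<le> supp S (dir \<alpha>)" "dir (\<alpha> + pi / 2) \<bullet> p \<le> supp S (dir (\<alpha> + pi / 2))"
    using supp_upper[OF _ p] assms(1) compact_imp_bounded by blast+
  ultimately show "p \<in> hallway \<alpha> (tight_corner S \<alpha>)"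
    unfolding hallway_iff tight_corner_def inner_diff_right using q r by auto
qed

text \<open>
  The motion keeps the tight hallway fixed: at time \<open>t\<close> the set is rotated by \<open>- t * \<beta>\<close> and its
  tight corner is moved to the origin. At the start the lower wall is respected because
  the set has height at most 1, and at the end the left wall because of the width condition.
\<close>

lemma moving_sofa_if_fits:
  assumes S: "S \<noteq> {}" "compact S" "connected S" "S \<subseteq> horiz_strip"
    and \<beta>: "0 \<le> \<beta>"
    and fits: "\<And>\<alpha>. 0 \<le> \<alpha> \<Longrightarrow> \<alpha> \<le> \<beta> \<Longrightarrow> fits \<alpha> S"
    and width: "\<And>p q. p \<in> S \<Longrightarrow> q \<in> S \<Longrightarrow> dir \<beta> \<bullet> (p - q) \<le> 1"
  shows "moving_sofa S"
proof -
  let ?u = "tight_corner S"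
  have bdd: "bounded S" using S compact_imp_bounded by blast
  have move: "rot (- \<alpha>) p + - ?u \<alpha> =
      (dir \<alpha> \<bullet> p - supp S (dir \<alpha>) + 1, dir (\<alpha> + pi / 2) \<bullet> p - supp S (dir (\<alpha> + pi / 2)) + 1)" for \<alpha> p
    by (simp add: rot_uminus_eq tight_corner_def)
  have upper: "dir \<alpha> \<bullet> p \<le> supp S (dir \<alpha>)" if "p \<in> S" for \<alpha> p
    using supp_upper[OF bdd that] .
  have supp0: "supp S (dir (pi / 2)) \<le> 1"
    using S by (intro supp_least) (auto simp: dir_inner horiz_strip_def)
  have cont: "continuous_on {0..1} (\<lambda>t. - ?u (t * \<beta>))"
    unfolding tight_corner_def
    by (intro continuous_intros continuous_on_compose2[OF continuous_on_supp[OF bdd S(1), of UNIV]]) auto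
  have inside: "rot (- (t * \<beta>)) p + - ?u (t * \<beta>) \<in> L_zero" if t: "t \<in> {0..1}" and p: "p \<in> S" for t p
  proof -
    have "t * \<beta> \<le> 1 * \<beta>" using t \<beta> by (intro mult_right_mono) auto
    then have "fits (t * \<beta>) S" using t \<beta> by (intro fits) auto
    then have "p \<in> hallway (t * \<beta>) (?u (t * \<beta>))"
      using fits_imp_subset_hallway S(2) p by blast
    then show ?thesis
      unfolding move hallway_iff by (auto simp: L_zero_def L_horiz_def L_vert_def tight_corner_def)
  qed
  have first: "rot (- (0 * \<beta>)) p + - ?u (0 * \<beta>) \<in> L_horiz" if p: "p \<in> S" for p
    unfolding move using upper[OF p, of 0] upper[OF p, of "pi / 2"] supp0 S(4) p
    by (auto simp: L_horiz_def horiz_strip_def dir_inner)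
  have last: "rot (- (1 * \<beta>)) p + - ?u (1 * \<beta>) \<in> L_vert" if p: "p \<in> S" for p
  proof -
    have "supp S (dir \<beta>) \<le> dir \<beta> \<bullet> p + 1"
      using width[OF _ p] S by (intro supp_least) (auto simp: inner_diff_right algebra_simps)
    then show ?thesis
      unfolding move using upper[OF p, of \<beta>] upper[OF p, of "\<beta> + pi / 2"]
      by (auto simp: L_vert_def)
  qed
  show ?thesis unfolding moving_sofa_def
  proof (intro conjI exI[of _ "\<lambda>t. - (t * \<beta>)"] exI[of _ "\<lambda>t. - ?u (t * \<beta>)"] S(1-3) cont)
    show "continuous_on {0..1} (\<lambda>t. - (t * \<beta>))" by (intro continuous_intros)
  qed (use inside first last in blast)+
qed

section \<open>Areas under rotations and from slices\<close>

text \<open>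
  Cavalieri's principle in the form needed for shears.
\<close>

lemma emeasure_eq_if_slices_translated:
  fixes A B :: "(real \<times> real) set"
  assumes AB: "A \<in> sets borel" "B \<in> sets borel"
    and slice: "\<And>y. (\<lambda>x. (x, y)) -` B = (+) (f y) ` ((\<lambda>x. (x, y)) -` A)"
  shows "emeasure lborel B = emeasure lborel A"
proof -
  have sets: "A \<in> sets (lborel \<Otimes>\<^sub>M lborel)" "B \<in> sets (lborel \<Otimes>\<^sub>M lborel)"
    using AB by (metis lborel_prod sets_lborel)+
  have "emeasure lborel ((\<lambda>x. (x, y)) -` B) = emeasure lborel ((\<lambda>x. (x, y)) -` A)" for y
  proof -
    have m: "(\<lambda>x. (x, y)) -` A \<in> sets borel" "(\<lambda>x. (x, y)) -` B \<in> sets borel"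
      using sets_Pair2[OF sets(1), of y] sets_Pair2[OF sets(2), of y] by simp_all
    have "emeasure lebesgue ((+) (f y) ` ((\<lambda>x. (x, y)) -` A)) = emeasure lebesgue ((\<lambda>x. (x, y)) -` A)"
      using emeasure_lebesgue_affine[of 1 "f y" "(\<lambda>x. (x, y)) -` A"] by (simp add: add.commute)
    then show ?thesis using m slice[of y] by (simp add: emeasure_completion)
  qed
  then show ?thesis
    using lborel_pair.emeasure_pair_measure_alt2[OF sets(1)]
      lborel_pair.emeasure_pair_measure_alt2[OF sets(2)]
    by (simp add: lborel_prod)
qed

lemma emeasure_swap:
  fixes A :: "(real \<times> real) set"
  assumes "A \<in> sets borel"
  shows "emeasure lborel (prod.swap -` A) = emeasure lborel A"
proof -
  have A: "A \<in> sets (lborel \<Otimes>\<^sub>M lborel)" using assms by (metis lborel_prod sets_lborel)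
  have "emeasure (distr (lborel \<Otimes>\<^sub>M lborel) (lborel \<Otimes>\<^sub>M lborel) (\<lambda>(x, y). (y, x))) A =
     emeasure (lborel \<Otimes>\<^sub>M lborel :: (real \<times> real) measure) A"
    using lborel_pair.distr_pair_swap by metis
  moreover have "(\<lambda>(x, y). (y, x)) -` A = prod.swap -` A" by auto
  ultimately show ?thesis
    using emeasure_distr[OF measurable_pair_swap', of A lborel lborel] A
    by (simp add: lborel_prod)
qed

definition shear_x :: "real \<Rightarrow> real \<times> real \<Rightarrow> real \<times> real" where
  "shear_x t p = (fst p + t * snd p, snd p)"

definition shear_y :: "real \<Rightarrow> real \<times> real \<Rightarrow> real \<times> real" where
  "shear_y t p = (fst p, snd p + t * fst p)"

lemma compact_shear_x: "compact S \<Longrightarrow> compact (shear_x t ` S)"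
  unfolding shear_x_def by (intro compact_continuous_image continuous_intros)

lemma compact_shear_y: "compact S \<Longrightarrow> compact (shear_y t ` S)"
  unfolding shear_y_def by (intro compact_continuous_image continuous_intros)

lemma emeasure_shear_x:
  assumes "compact S"
  shows "emeasure lborel (shear_x t ` S) = emeasure lborel S"
proof (rule emeasure_eq_if_slices_translated)
  show "(\<lambda>x. (x, y)) -` (shear_x t ` S) = (+) (t * y) ` ((\<lambda>x. (x, y)) -` S)" for y
  proof (intro set_eqI iffI)
    fix x assume "x \<in> (\<lambda>x. (x, y)) -` (shear_x t ` S)"
    then obtain p where "p \<in> S" "(x, y) = shear_x t p" by auto
    then show "x \<in> (+) (t * y) ` ((\<lambda>x. (x, y)) -` S)"
      by (intro image_eqI[of _ _ "fst p"]) (auto simp: shear_x_def)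
  qed (auto simp: shear_x_def intro!: image_eqI)
qed (use assms compact_shear_x in \<open>auto intro: borel_compact\<close>)

lemma emeasure_shear_y:
  assumes "compact S"
  shows "emeasure lborel (shear_y t ` S) = emeasure lborel S"
proof -
  have swap: "prod.swap -` X = prod.swap ` X" for X :: "(real \<times> real) set"
    by (force simp: image_iff)
  have comp: "compact (prod.swap ` S)"
    unfolding prod.swap_def using assms by (intro compact_continuous_image continuous_intros)
  have eq: "shear_y t ` S = prod.swap -` (shear_x t ` prod.swap ` S)"
    unfolding swap by (auto simp: shear_x_def shear_y_def image_image)
  have "emeasure lborel (shear_y t ` S) = emeasure lborel (shear_x t ` prod.swap ` S)"
    unfolding eq using comp compact_shear_x by (intro emeasure_swap borel_compact)
  also have "\<dots> = emeasure lborel (prod.swap -` S)"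
    using emeasure_shear_x[OF comp] by (simp add: swap)
  also have "\<dots> = emeasure lborel S"
    using assms by (intro emeasure_swap borel_compact)
  finally show ?thesis .
qed

text \<open>
  Three shears reduce the rotation invariance of area to Cavalieri's principle. Rotations by
  odd multiples of \<open>\<pi>\<close> have no such factorisation; they are point reflections.
\<close>

lemma rot_eq_shears:
  assumes "cos (\<theta> / 2) \<noteq> 0"
  shows "rot \<theta> p = shear_x (- tan (\<theta> / 2)) (shear_y (sin \<theta>) (shear_x (- tan (\<theta> / 2)) p))"
proof -
  define s c where "s = sin (\<theta> / 2)" and "c = cos (\<theta> / 2)"
  have c: "c \<noteq> 0" using assms by (simp add: c_def)
  have sc: "s\<^sup>2 = 1 - c\<^sup>2" by (simp add: s_def c_def sin_squared_eq)
  have sin: "sin \<theta> = 2 * s * c" using sin_double[of "\<theta> / 2"] by (simp add: s_def c_def)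
  have cos: "cos \<theta> = 2 * c\<^sup>2 - 1" using cos_double_cos[of "\<theta> / 2"] by (simp add: c_def)
  have tan: "tan (\<theta> / 2) = s / c" by (simp add: tan_def s_def c_def)
  have 1: "(s / c) * (2 * s * c) = 2 - 2 * c\<^sup>2"
    using c sc by (simp add: power2_eq_square field_simps)
  have 2: "(s / c) * (2 * c\<^sup>2) = 2 * s * c" using c by (simp add: power2_eq_square)
  obtain x y where p: "p = (x, y)" by (cases p)
  have "y + 2 * s * c * (x - (s / c) * y) = x * (2 * s * c) + y * (1 - (s / c) * (2 * s * c))"
    by (simp add: algebra_simps)
  then have snd: "y + 2 * s * c * (x - (s / c) * y) = x * (2 * s * c) + y * (2 * c\<^sup>2 - 1)"
    unfolding 1 by simp
  have "x - (s / c) * y - (s / c) * (x * (2 * s * c) + y * (2 * c\<^sup>2 - 1)) =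
      x * (1 - (s / c) * (2 * s * c)) - y * ((s / c) * (2 * c\<^sup>2))"
    by (simp add: algebra_simps)
  then have fst: "x - (s / c) * y - (s / c) * (x * (2 * s * c) + y * (2 * c\<^sup>2 - 1)) =
      x * (2 * c\<^sup>2 - 1) - y * (2 * s * c)"
    unfolding 1 2 by simp
  show ?thesis
    using fst snd unfolding p rot_def shear_x_def shear_y_def sin cos tan by simp
qed

lemma emeasure_rot:
  assumes "compact S"
  shows "emeasure lebesgue (rot \<theta> ` S) = emeasure lebesgue S"
proof (cases "cos (\<theta> / 2) = 0")
  case True
  have "cos \<theta> = -1" "sin \<theta> = 0"
    using True cos_double_cos[of "\<theta> / 2"] sin_double[of "\<theta> / 2"] by simp_all
  then have "rot \<theta> = (\<lambda>p. (-1) *\<^sub>R p + 0)" by (auto simp: rot_def fun_eq_iff)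
  then show ?thesis using emeasure_lebesgue_affine[of "-1" 0 S] by simp
next
  case False
  have eq: "rot \<theta> ` S = shear_x (- tan (\<theta> / 2)) ` shear_y (sin \<theta>) ` shear_x (- tan (\<theta> / 2)) ` S"
    unfolding image_image by (simp add: rot_eq_shears[OF False])
  have "compact (rot \<theta> ` S)"
    unfolding eq using assms by (intro compact_shear_x compact_shear_y)
  moreover have "emeasure lborel (rot \<theta> ` S) = emeasure lborel S"
    unfolding eq using assms
    by (simp add: emeasure_shear_x emeasure_shear_y compact_shear_x compact_shear_y)
  ultimately show ?thesis
    using assms by (simp add: emeasure_completion borel_compact)
qed

lemma emeasure_translate:
  "emeasure lebesgue ((+) v ` S) = emeasure lebesgue (S :: (real \<times> real) set)"
  using emeasure_lebesgue_affine[of 1 v S] by (simp add: add.commute)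

lemma emeasure_le_slice_length:
  assumes S: "compact S" "S \<subseteq> horiz_strip"
    and slice: "\<And>x x' y. (x, y) \<in> S \<Longrightarrow> (x', y) \<in> S \<Longrightarrow> x' - x \<le> l" and "0 \<le> l"
  shows "emeasure lebesgue S \<le> ennreal l"
proof -
  have S': "S \<in> sets (lborel \<Otimes>\<^sub>M lborel)" using S borel_compact by (metis lborel_prod sets_lborel)
  have "emeasure lebesgue S = emeasure lborel S" using S by (simp add: emeasure_completion borel_compact)
  also have "\<dots> = (\<integral>\<^sup>+y. emeasure lborel ((\<lambda>x. (x, y)) -` S) \<partial>lborel)"
    using lborel_pair.emeasure_pair_measure_alt2[OF S'] by (simp add: lborel_prod)
  also have "\<dots> \<le> (\<integral>\<^sup>+y. ennreal l * indicator {0..1::real} y \<partial>lborel)"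
  proof (rule nn_integral_mono)
    fix y :: real
    let ?X = "(\<lambda>x. (x, y)) -` S"
    show "emeasure lborel ?X \<le> ennreal l * indicator {0..1} y"
    proof (cases "?X = {}")
      case False
      then have y: "y \<in> {0..1}" using S(2) by (auto simp: horiz_strip_def)
      have "?X = fst ` (S \<inter> UNIV \<times> {y})" by force
      moreover have "compact (S \<inter> UNIV \<times> {y})"
        using S(1) by (intro compact_Int_closed closed_Times) auto
      ultimately have "compact ?X" by (simp add: compact_continuous_image continuous_on_fst)
      then obtain m where m: "m \<in> ?X" "\<And>x. x \<in> ?X \<Longrightarrow> m \<le> x"
        using compact_attains_inf[OF _ False] by blast
      have "?X \<subseteq> {m..m + l}" using m slice[of m y] by fastforce
      then have "emeasure lborel ?X \<le> emeasure lborel {m..m + l}" by (intro emeasure_mono) auto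
      then show ?thesis using y \<open>0 \<le> l\<close> by simp
    qed simp
  qed
  also have "\<dots> = ennreal l" by (simp add: nn_integral_cmult)
  finally show ?thesis .
qed

section \<open>The discrete regions\<close>

lemma horiz_strip_iff: "p \<in> horiz_strip \<longleftrightarrow> 0 \<le> snd p \<and> snd p \<le> 1"
  by (cases p) (auto simp: horiz_strip_def)

lemma butterfly_iff:
  "p \<in> butterfly \<beta>\<^sub>1 \<beta>\<^sub>2 \<longleftrightarrow>
     (0 \<le> dir \<beta>\<^sub>1 \<bullet> p \<and> dir \<beta>\<^sub>2 \<bullet> p \<le> 1) \<or> (dir \<beta>\<^sub>1 \<bullet> p \<le> 1 \<and> 0 \<le> dir \<beta>\<^sub>2 \<bullet> p)"
  by (cases p) (auto simp: butterfly_def dir_inner)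

lemma closed_hallway: "closed (hallway \<alpha> u)"
proof -
  have "hallway \<alpha> u = {p. dir \<alpha> \<bullet> p \<le> fst u + 1} \<inter> {p. dir (\<alpha> + pi / 2) \<bullet> p \<le> snd u + 1} \<inter>
      ({p. fst u \<le> dir \<alpha> \<bullet> p} \<union> {p. snd u \<le> dir (\<alpha> + pi / 2) \<bullet> p})"
    by (auto simp: hallway_iff)
  also have "closed \<dots>"
    by (intro closed_Int closed_Un closed_Collect_le continuous_intros)
  finally show ?thesis .
qed

lemma closed_butterfly: "closed (butterfly \<beta>\<^sub>1 \<beta>\<^sub>2)"
proof -
  have "butterfly \<beta>\<^sub>1 \<beta>\<^sub>2 = ({p. 0 \<le> dir \<beta>\<^sub>1 \<bullet> p} \<inter> {p. dir \<beta>\<^sub>2 \<bullet> p \<le> 1}) \<union>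
      ({p. dir \<beta>\<^sub>1 \<bullet> p \<le> 1} \<inter> {p. 0 \<le> dir \<beta>\<^sub>2 \<bullet> p})"
    by (auto simp: butterfly_iff)
  also have "closed \<dots>"
    by (intro closed_Int closed_Un closed_Collect_le continuous_intros)
  finally show ?thesis .
qed

lemma closed_horiz_strip: "closed horiz_strip"
  unfolding horiz_strip_def by (intro closed_Times) auto

definition discrete_region :: "nat \<Rightarrow> nat \<Rightarrow> (nat \<Rightarrow> real \<times> real) \<Rightarrow> (real \<times> real) set" where
  "discrete_region n k u =
     horiz_strip \<inter> (\<Inter>j<length (angles n k). hallway (angles n k ! j) (u j)) \<inter>
     butterfly (gamma1 n k) (gamma2 n k)"

lemma G_sup_eq:
  "G_sup (angles n k) (gamma1 n k) (gamma2 n k) = (SUP u. lambda_star (discrete_region n k u))"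
  by (simp add: G_sup_def discrete_region_def)

lemma closed_discrete_region: "closed (discrete_region n k u)"
  unfolding discrete_region_def
  by (intro closed_Int closed_INT ballI closed_horiz_strip closed_hallway closed_butterfly)

lemma emeasure_le_lambda_star:
  assumes "closed X" "S \<subseteq> X" "S \<noteq> {}" "connected S"
  shows "emeasure lebesgue S \<le> lambda_star X"
proof -
  obtain C where C: "C \<in> components X" "S \<subseteq> C"
    using exists_component_superset[of S X] assms by blast
  have "closed C" using assms(1) C(1) closed_components by blast
  then have "emeasure lebesgue S \<le> emeasure lebesgue C"
    using C(2) by (intro emeasure_mono) auto
  also have "\<dots> \<le> lambda_star X"
    unfolding lambda_star_def using C(1) by (rule SUP_upper)
  finally show ?thesis .
qed

text \<open>
  Wherever \<open>S\<close> lies, \<open>fits\<close> supplies hallways that contain it; the strip and the butterfly do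
  not move along.
\<close>

lemma emeasure_le_W:
  assumes S: "S \<noteq> {}" "compact S" "connected S" "S \<subseteq> horiz_strip"
    and k: "k \<in> {1..nat \<lceil>real n / 3\<rceil>}"
    and fits: "\<And>\<alpha>. \<alpha> \<in> set (angles n k) \<Longrightarrow> fits \<alpha> S"
    and butterfly: "S \<subseteq> butterfly (gamma1 n k) (gamma2 n k)"
  shows "emeasure lebesgue S \<le> W n"
proof -
  let ?u = "\<lambda>j. tight_corner S (angles n k ! j)"
  have "S \<subseteq> hallway (angles n k ! j) (?u j)" if "j < length (angles n k)" for j
    using that by (intro fits_imp_subset_hallway S(2) fits) auto
  then have "S \<subseteq> discrete_region n k ?u" unfolding discrete_region_def using S(4) butterfly by blast
  then have "emeasure lebesgue S \<le> lambda_star (discrete_region n k ?u)"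
    using S by (intro emeasure_le_lambda_star closed_discrete_region)
  also have "\<dots> \<le> G_sup (angles n k) (gamma1 n k) (gamma2 n k)"
    unfolding G_sup_eq by (rule SUP_upper) simp
  also have "\<dots> \<le> W n"
    unfolding W_def using k by (intro Max_ge) auto
  finally show ?thesis .
qed

text \<open>
  For \<open>k = 1\<close> the second angle is \<open>\<pi>/2\<close>, so the two conditions on it are those of the horizontal strip.
\<close>

lemma butterfly_one_eq:
  assumes "n > 0" "p \<in> horiz_strip"
  shows "p \<in> butterfly (gamma1 n 1) (gamma2 n 1)"
proof -
  have half_pi: "gamma2 n 1 = pi / 2" using assms(1) by (simp add: gamma2_def)
  show ?thesis using assms(2)
    unfolding butterfly_iff half_pi by (auto simp: dir_inner horiz_strip_iff)
qed

lemma angles_bounds: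
  assumes "\<alpha> \<in> set (angles n k)"
  shows "0 \<le> \<alpha>" "\<alpha> \<le> gamma1 n k" "\<alpha> \<le> pi / 2"
proof -
  obtain j where j: "1 \<le> j" "j < n - k" "\<alpha> = real j / real n * (pi / 2)"
    using assms by (auto simp: angles_def)
  have le: "real j \<le> real n - real k" and n: "n > 0" using j by linarith+
  show "0 \<le> \<alpha>" using j(3) by simp
  show "\<alpha> \<le> gamma1 n k"
    unfolding gamma1_def j(3) using le by (intro mult_right_mono divide_right_mono) auto
  also have "\<dots> \<le> 1 * (pi / 2)" unfolding gamma1_def using n by (intro mult_right_mono) auto
  finally show "\<alpha> \<le> pi / 2" by simp
qed

text \<open>
  The butterfly contains the part in the horizontal strip of every unit strip of an
  intermediate angle. To the left of the vertical axis \<open>dir b \<bullet> p\<close> increases with \<open>b\<close>. To its right both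
  products are nonnegative, and one of them is at most 1, since
  \<open>dir \<beta>\<close> is a nonnegative combination of \<open>dir \<beta>\<^sub>1\<close> and \<open>dir \<beta>\<^sub>2\<close> with coefficients of sum at least 1.
\<close>

lemma in_butterfly_if_in_strip:
  assumes \<beta>: "0 \<le> \<beta>\<^sub>1" "\<beta>\<^sub>1 \<le> \<beta>" "\<beta> \<le> \<beta>\<^sub>2" "\<beta>\<^sub>2 \<le> pi / 2"
    and p: "p \<in> horiz_strip" "0 \<le> dir \<beta> \<bullet> p" "dir \<beta> \<bullet> p \<le> 1"
  shows "p \<in> butterfly \<beta>\<^sub>1 \<beta>\<^sub>2"
proof -
  have y: "0 \<le> snd p" using p(1) by (simp add: horiz_strip_iff)
  have cos_mono: "cos b \<ge> cos b'" and sin_mono: "sin b \<le> sin b'"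
    if "0 \<le> b" "b \<le> b'" "b' \<le> pi / 2" for b b'
    using that by (auto intro!: cos_monotone_0_pi_le sin_monotone_2pi_le)
  show ?thesis
  proof (cases "fst p < 0")
    case True
    have mono: "dir b \<bullet> p \<le> dir b' \<bullet> p" if "0 \<le> b" "b \<le> b'" "b' \<le> pi / 2" for b b'
      unfolding dir_inner using True y cos_mono[OF that] sin_mono[OF that]
      by (intro add_mono mult_left_mono mult_left_mono_neg) auto
    have "dir \<beta>\<^sub>1 \<bullet> p \<le> dir \<beta> \<bullet> p" "dir \<beta> \<bullet> p \<le> dir \<beta>\<^sub>2 \<bullet> p" using \<beta> by (auto intro!: mono)
    then show ?thesis using p by (auto simp: butterfly_iff)
  next
    case False
    have pos: "0 \<le> dir b \<bullet> p" if "0 \<le> b" "b \<le> pi / 2" for b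
      unfolding dir_inner using False y that
      by (intro add_nonneg_nonneg mult_nonneg_nonneg cos_ge_zero sin_ge_zero) auto
    have "dir \<beta>\<^sub>1 \<bullet> p \<le> 1 \<or> dir \<beta>\<^sub>2 \<bullet> p \<le> 1"
    proof (rule ccontr)
      assume "\<not> ?thesis"
      then have gt: "dir \<beta>\<^sub>1 \<bullet> p > 1" "dir \<beta>\<^sub>2 \<bullet> p > 1" by auto
      define s t where "s = \<beta>\<^sub>2 - \<beta>" and "t = \<beta> - \<beta>\<^sub>1"
      have st: "0 \<le> s" "0 \<le> t" "s + t \<le> pi / 2" "\<beta>\<^sub>2 = \<beta> + s" "\<beta>\<^sub>1 = \<beta> - t"
        using \<beta> by (auto simp: s_def t_def)
      have sin0: "0 \<le> sin s" "0 \<le> sin t" using st by (auto intro!: sin_ge_zero)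
      have comb: "sin (s + t) * (dir \<beta> \<bullet> p) = sin s * (dir \<beta>\<^sub>1 \<bullet> p) + sin t * (dir \<beta>\<^sub>2 \<bullet> p)"
        unfolding st(4,5) dir_inner sin_add cos_add sin_diff cos_diff by algebra
      have "sin (s + t) \<le> sin s + sin t"
        unfolding sin_add using sin0 mult_left_mono[of "cos t" 1 "sin s"] mult_left_mono[of "cos s" 1 "sin t"]
        by (simp add: mult.commute)
      show False
      proof (cases "s = 0 \<and> t = 0")
        case True
        then show False using gt p(3) st by simp
      next
        case False
        then have "sin s > 0 \<or> sin t > 0" using st by (auto intro!: sin_gt_zero)
        then have "sin s + sin t < sin s * (dir \<beta>\<^sub>1 \<bullet> p) + sin t * (dir \<beta>\<^sub>2 \<bullet> p)"
        proof
          assume "sin s > 0"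
          then show ?thesis
            using mult_strict_left_mono[OF gt(1), of "sin s"] mult_left_mono[of 1 "dir \<beta>\<^sub>2 \<bullet> p" "sin t"] gt(2) sin0
            by linarith
        next
          assume "sin t > 0"
          then show ?thesis
            using mult_strict_left_mono[OF gt(2), of "sin t"] mult_left_mono[of 1 "dir \<beta>\<^sub>1 \<bullet> p" "sin s"] gt(1) sin0
            by linarith
        qed
        moreover have "sin (s + t) * (dir \<beta> \<bullet> p) \<le> sin (s + t)"
          using st p(3) by (intro mult_left_le sin_ge_zero) auto
        ultimately show False using comb \<open>sin (s + t) \<le> sin s + sin t\<close> by linarith
      qed
    qed
    then show ?thesis using pos[of \<beta>\<^sub>1] pos[of \<beta>\<^sub>2] \<beta> by (auto simp: butterfly_iff)
  qed
qed

section \<open>Sofas that turn by more than sixty degrees\<close>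

lemma connected_translate: "connected S \<Longrightarrow> connected ((+) v ` S)" for v :: "real \<times> real"
  by (rule connected_continuous_image[of S "(+) v"]) (intro continuous_intros)

text \<open>
  The bound \<open>k \<le> \<lceil>n/3\<rceil>\<close> is where \<open>\<beta> > \<pi>/3\<close> is used.
  The strip of width 1 that holds the sofa in its last position is translated
  horizontally to the origin, where the butterfly expects it.
\<close>

lemma emeasure_le_W_if_turn:
  assumes n: "n \<ge> 3"
    and S: "S \<noteq> {}" "compact S" "connected S" "S \<subseteq> horiz_strip"
    and \<beta>: "pi / 3 < \<beta>"
    and fits: "\<And>\<alpha>. 0 \<le> \<alpha> \<Longrightarrow> \<alpha> \<le> \<beta> \<Longrightarrow> fits \<alpha> S"
    and width: "\<And>p q. p \<in> S \<Longrightarrow> q \<in> S \<Longrightarrow> dir \<beta> \<bullet> (p - q) \<le> 1"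
  shows "emeasure lebesgue S \<le> W n"
proof (cases "\<beta> < pi / 2")
  case False
  show ?thesis
  proof (rule emeasure_le_W[OF S, of 1])
    show "1 \<in> {1..nat \<lceil>real n / 3\<rceil>}" using n by (simp add: le_nat_iff one_le_ceiling)
    show "fits \<alpha> S" if "\<alpha> \<in> set (angles n 1)" for \<alpha>
      using angles_bounds[OF that] False by (intro fits) auto
    show "S \<subseteq> butterfly (gamma1 n 1) (gamma2 n 1)"
      using S(4) n butterfly_one_eq[of n] by auto
  qed
next
  case True
  define z where "z = \<beta> * real n * 2 / pi"
  \<comment> \<open>\<open>\<beta>\<close> lies between the multiples \<open>m\<close> and \<open>m + 1\<close> of \<open>\<pi>/2\<close> divided by \<open>n\<close>.\<close>
  define m where "m = nat \<lfloor>z\<rfloor>"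
  define k where "k = n - m"
  have \<beta>z: "\<beta> = z / real n * (pi / 2)" using n by (simp add: z_def)
  have z: "2 * real n / 3 < z" "z < real n" "z \<ge> 0"
    using n \<beta> True by (auto simp: z_def field_simps)
  have m: "real m \<le> z" "z < real m + 1"
    using z by (auto simp: m_def)
  have mn: "m < n" using m z by linarith
  have rk: "real k = real n - real m" using mn by (simp add: k_def of_nat_diff)
  have k: "k \<in> {1..nat \<lceil>real n / 3\<rceil>}"
  proof -
    have "real n - of_int \<lceil>real n / 3\<rceil> < z" using z(1) by linarith
    then have "int n - \<lceil>real n / 3\<rceil> \<le> \<lfloor>z\<rfloor>" by (simp add: le_floor_iff)
    then show ?thesis using mn z unfolding k_def m_def atLeastAtMost_iff by linarith
  qed
  have g1: "0 \<le> gamma1 n k" "gamma1 n k \<le> \<beta>"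
    unfolding gamma1_def rk \<beta>z using m by (auto intro!: divide_right_mono mult_right_mono)
  have g2: "\<beta> \<le> gamma2 n k"
    unfolding gamma2_def rk \<beta>z using m by (intro divide_right_mono mult_right_mono) auto
  have "gamma2 n k \<le> 1 * (pi / 2)"
    unfolding gamma2_def rk using mn by (intro mult_right_mono) auto
  then have g3: "gamma2 n k \<le> pi / 2" by simp
  obtain q where q: "q \<in> S" "\<And>p. p \<in> S \<Longrightarrow> dir \<beta> \<bullet> q \<le> dir \<beta> \<bullet> p"
    using continuous_attains_inf[OF S(2,1) continuous_on_inner[OF continuous_on_const continuous_on_id]]
    by blast
  have cos: "cos \<beta> > 0" using \<beta> True by (intro cos_gt_zero) auto
  \<comment> \<open>The translation takes \<open>q\<close>, a point that is lowest in direction \<open>dir \<beta>\<close>, to the line through 0.\<close>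
  define v where "v = (- (dir \<beta> \<bullet> q) / cos \<beta>, 0 :: real)"
  have v: "dir \<beta> \<bullet> v = - (dir \<beta> \<bullet> q)" using cos by (simp add: v_def dir_inner[of \<beta> "(_, _)"])
  have strip: "(+) v ` S \<subseteq> horiz_strip" using S(4) by (auto simp: horiz_strip_iff v_def)
  have "emeasure lebesgue ((+) v ` S) \<le> W n"
  proof (rule emeasure_le_W)
    show "fits \<alpha> ((+) v ` S)" if "\<alpha> \<in> set (angles n k)" for \<alpha>
      unfolding fits_translation using angles_bounds[OF that] g1 by (intro fits) auto
    show "(+) v ` S \<subseteq> butterfly (gamma1 n k) (gamma2 n k)"
    proof
      fix p assume p: "p \<in> (+) v ` S"
      then obtain p' where p': "p' \<in> S" "p = v + p'" by blast
      show "p \<in> butterfly (gamma1 n k) (gamma2 n k)"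
        using q(2)[OF p'(1)] width[OF p'(1) q(1)] strip p
        by (intro in_butterfly_if_in_strip[OF g1 g2 g3])
          (auto simp: p'(2) inner_add_right v inner_diff_right)
    qed
  qed (use S k strip in \<open>auto intro: compact_translation connected_translate\<close>)
  then show ?thesis by (simp add: emeasure_translate)
qed

lemma rot_add: "rot \<theta> (p + q) = rot \<theta> p + rot \<theta> q"
  by (simp add: rot_def case_prod_unfold algebra_simps)

lemma rot_rot: "rot \<theta> (rot \<phi> p) = rot (\<theta> + \<phi>) p"
  by (simp add: rot_def case_prod_unfold cos_add sin_add algebra_simps)

lemma continuous_on_rot: "continuous_on X (rot \<theta>)"
  unfolding rot_def case_prod_unfold by (intro continuous_intros)

text \<open>
  In the coordinates of its first position the sofa rests and the hallway moves. The angle of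
  the hallway starts at 0 and changes continuously, so it takes every value up to the
  last one. The total turn \<open>\<beta>\<close> may have either sign and any size.
\<close>

lemma moving_sofa_normalised:
  assumes "moving_sofa S"
  obtains T \<beta> where "T \<noteq> {}" "compact T" "connected T" "T \<subseteq> horiz_strip"
    "emeasure lebesgue T = emeasure lebesgue S"
    "\<And>\<alpha>. \<alpha> \<in> closed_segment 0 \<beta> \<Longrightarrow> fits \<alpha> T"
    "\<And>p q. p \<in> T \<Longrightarrow> q \<in> T \<Longrightarrow> dir \<beta> \<bullet> (p - q) \<le> 1"
proof -
  obtain \<theta> :: "real \<Rightarrow> real" and c :: "real \<Rightarrow> real \<times> real" where S: "S \<noteq> {}" "compact S" "connected S" and \<theta>: "continuous_on {0..1} \<theta>"
    and inside: "\<forall>t\<in>{0..1}. \<forall>p\<in>S. rot (\<theta> t) p + c t \<in> L_zero"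
    and first: "\<forall>p\<in>S. rot (\<theta> 0) p + c 0 \<in> L_horiz"
    and last: "\<forall>p\<in>S. rot (\<theta> 1) p + c 1 \<in> L_vert"
    using assms unfolding moving_sofa_def image_subset_iff by blast
  define T where "T = (\<lambda>p. rot (\<theta> 0) p + c 0) ` S"
  define \<alpha> where "\<alpha> t = \<theta> 0 - \<theta> t" for t
  define w where "w t = c t - rot (- \<alpha> t) (c 0)" for t
  have move: "rot (\<theta> t) p + c t =
      (dir (\<alpha> t) \<bullet> q + fst (w t), dir (\<alpha> t + pi / 2) \<bullet> q + snd (w t))"
    if "q = rot (\<theta> 0) p + c 0" for t p q
  proof -
    have "rot (\<theta> t) p + c t = rot (- \<alpha> t) q + w t"
      unfolding that rot_add rot_rot w_def by (simp add: \<alpha>_def)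
    then show ?thesis by (simp add: rot_uminus_eq prod_eq_iff)
  qed
  have fits: "fits (\<alpha> t) T" if "t \<in> {0..1}" for t
  proof (rule fits_if_subset_hallway)
    show "T \<subseteq> hallway (\<alpha> t) (- w t)"
    proof
      fix q assume "q \<in> T"
      then obtain p where p: "p \<in> S" "q = rot (\<theta> 0) p + c 0" by (auto simp: T_def)
      show "q \<in> hallway (\<alpha> t) (- w t)"
        using inside[rule_format, OF that p(1)] unfolding move[OF p(2)]
        by (auto simp: hallway_iff L_zero_def L_horiz_def L_vert_def)
    qed
  qed
  show thesis
  proof (rule that[of T "\<alpha> 1"])
    show "T \<noteq> {}" using S by (simp add: T_def)
    show "compact T" "connected T" unfolding T_def using S
      by (auto intro!: compact_continuous_image connected_continuous_image continuous_intros continuous_on_rot)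
    show "T \<subseteq> horiz_strip" using first by (auto simp: T_def L_horiz_def horiz_strip_iff mem_Times_iff)
    have "T = (+) (c 0) ` rot (\<theta> 0) ` S" by (simp add: T_def image_image add.commute)
    then show "emeasure lebesgue T = emeasure lebesgue S"
      using S by (simp add: emeasure_translate emeasure_rot)
    show "fits a T" if "a \<in> closed_segment 0 (\<alpha> 1)" for a
    proof -
      have "connected (\<alpha> ` {0..1})"
        unfolding \<alpha>_def by (intro connected_continuous_image continuous_intros \<theta>) auto
      moreover have "0 \<in> \<alpha> ` {0..1}" "\<alpha> 1 \<in> \<alpha> ` {0..1}"
        by (auto simp: \<alpha>_def image_iff intro: bexI[of _ 0])
      ultimately have "a \<in> \<alpha> ` {0..1}"
        using that connectedD_interval[of "\<alpha> ` {0..1}" 0 "\<alpha> 1" a] connectedD_interval[of "\<alpha> ` {0..1}" "\<alpha> 1" 0 a]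
        by (simp add: closed_segment_eq_real_ivl split: if_splits)
      then show ?thesis using fits by blast
    qed
    show "dir (\<alpha> 1) \<bullet> (p - q) \<le> 1" if pq: "p \<in> T" "q \<in> T" for p q
    proof -
      obtain p' q' where p': "p' \<in> S" "p = rot (\<theta> 0) p' + c 0" and q': "q' \<in> S" "q = rot (\<theta> 0) q' + c 0"
        using pq unfolding T_def by blast
      show ?thesis
        using last[rule_format, OF p'(1)] last[rule_format, OF q'(1)] unfolding move[OF p'(2)] move[OF q'(2)]
        by (auto simp: L_vert_def inner_diff_right)
    qed
  qed
qed

section \<open>Sofas that turn little\<close>

lemma cos_ge_half: "\<bar>\<beta>\<bar> \<le> pi / 3 \<Longrightarrow> 1 / 2 \<le> cos \<beta>"
  using cos_monotone_0_pi_le[of "\<bar>\<beta>\<bar>" "pi / 3"] by (simp add: cos_60)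

text \<open>
  For \<open>\<bar>\<beta>\<bar> \<le> \<pi>/3\<close> the set lies in the intersection of two unit strips that meet at an angle of
  at least 30 degrees, and horizontal slices have length at most \<open>1 / cos \<beta> \<le> 2\<close>. If the turn
  in the wrong sense is larger than that, the hallway passes the angle \<open>-\<pi>/4\<close>; then its two legs
  are symmetric about a horizontal line, and horizontal slices have length at most \<open>sqrt 2\<close>.
\<close>

lemma emeasure_le_2_if_small_turn:
  assumes S: "compact S" "S \<subseteq> horiz_strip"
    and \<beta>: "\<beta> \<le> pi / 3"
    and fits: "\<And>\<alpha>. \<alpha> \<in> closed_segment 0 \<beta> \<Longrightarrow> fits \<alpha> S"
    and width: "\<And>p q. p \<in> S \<Longrightarrow> q \<in> S \<Longrightarrow> dir \<beta> \<bullet> (p - q) \<le> 1"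
  shows "emeasure lebesgue S \<le> 2"
proof -
  have "emeasure lebesgue S \<le> ennreal 2"
  proof (rule emeasure_le_slice_length[OF S])
    fix x x' y assume xy: "(x, y) \<in> S" "(x', y) \<in> S"
    show "x' - x \<le> 2"
    proof (cases "- (pi / 3) \<le> \<beta>")
      case True
      have cos: "1 / 2 \<le> cos \<beta>" using True \<beta> by (intro cos_ge_half) auto
      have "(x' - x) * cos \<beta> \<le> 1" using width[OF xy(2,1)] by (simp add: dir_inner)
      show ?thesis
      proof (rule ccontr)
        assume "\<not> x' - x \<le> 2"
        then have "(x' - x) * (1 / 2) > 1" by simp
        moreover have "(x' - x) * (1 / 2) \<le> (x' - x) * cos \<beta>"
          using cos \<open>\<not> x' - x \<le> 2\<close> by (intro mult_left_mono) auto
        ultimately show False using \<open>(x' - x) * cos \<beta> \<le> 1\<close> by linarith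
      qed
    next
      case False
      then have "\<beta> \<le> - (pi / 4)" "\<beta> < 0" using pi_gt_zero by linarith+
      then have "- (pi / 4) \<in> closed_segment 0 \<beta>" by (auto simp: closed_segment_eq_real_ivl)
      then have "fits (- (pi / 4)) S" by (rule fits)
      then have "dir (- (pi / 4)) \<bullet> ((x', y) - (x, y)) \<le> 1 \<or>
          dir (- (pi / 4) + pi / 2) \<bullet> ((x', y) - (x, y)) \<le> 1"
        using xy unfolding fits_def by blast
      then have *: "(x' - x) * (sqrt 2 / 2) \<le> 1"
        unfolding dir_quarter_inner by (auto simp: dir_inner cos_45 sin_45 algebra_simps)
      show ?thesis
      proof (rule ccontr)
        assume "\<not> x' - x \<le> 2"
        then have "2 * (sqrt 2 / 2) < (x' - x) * (sqrt 2 / 2)" by (intro mult_strict_right_mono) auto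
        moreover have "sqrt 2 > 1" by simp
        ultimately show False using * by linarith
      qed
    qed
  qed auto
  then show ?thesis by simp
qed

definition quarter_left :: "(real \<times> real) set" where
  "quarter_left = cball 0 1 \<inter> {..0} \<times> {0..}"

definition quarter_right :: "(real \<times> real) set" where
  "quarter_right = cball 0 1 \<inter> {0..} \<times> {0..}"

text \<open>
  A subset of Hammersley's sofa with inner radius 1/2: the half disc that is cut out from below is
  enlarged to the rectangle around it, so that only a rectangle remains between the quarter discs.
\<close>

definition Hammersley_sofa :: "(real \<times> real) set" where
  "Hammersley_sofa =
     (+) (- 1/2, 0) ` quarter_left \<union> {- 1/2..1/2} \<times> {1/2..1} \<union> (+) (1/2, 0) ` quarter_right"

lemma compact_convex_quarters:
  "compact quarter_left" "compact quarter_right" "convex quarter_left" "convex quarter_right"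
  unfolding quarter_left_def quarter_right_def
  by (auto intro!: compact_Int_closed closed_Times convex_Int convex_Times)

lemma compact_Hammersley: "compact Hammersley_sofa"
  unfolding Hammersley_sofa_def
  by (intro compact_Un compact_translation compact_convex_quarters compact_Times compact_Icc)

lemma connected_Hammersley: "connected Hammersley_sofa"
proof -
  have mem: "(0, 1/2) \<in> quarter_left" "(0, 1/2) \<in> quarter_right"
    by (auto simp: quarter_left_def quarter_right_def norm_Pair)
  have conn: "connected ((+) v ` quarter_left)" "connected ((+) v ` quarter_right)" for v
    by (simp_all add: compact_convex_quarters connected_translate convex_connected)
  have "(- 1/2, 1/2) \<in> (+) (- 1/2, 0) ` quarter_left"
    by (rule image_eqI[OF _ mem(1)]) simp
  moreover have "(- 1/2, 1/2) \<in> {- 1/2..1/2 :: real} \<times> {1/2..1 :: real}" "(1/2, 1/2) \<in> {- 1/2..1/2 :: real} \<times> {1/2..1 :: real}"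
    by simp_all
  ultimately have meet: "(+) (- 1/2, 0) ` quarter_left \<inter> {- 1/2..1/2} \<times> {1/2..1} \<noteq> {}"
    and "(1/2, 1/2) \<in> (+) (- 1/2, 0) ` quarter_left \<union> {- 1/2..1/2} \<times> {1/2..1}"
    by (metis IntI empty_iff, metis UnI2)
  moreover have "(1/2, 1/2) \<in> (+) (1/2, 0) ` quarter_right"
    by (rule image_eqI[OF _ mem(2)]) simp
  ultimately have "((+) (- 1/2, 0) ` quarter_left \<union> {- 1/2..1/2} \<times> {1/2..1}) \<inter>
      (+) (1/2, 0) ` quarter_right \<noteq> {}"
    by (metis IntI empty_iff)
  with meet show ?thesis
    unfolding Hammersley_sofa_def by (intro connected_Un conn connected_Times connected_Icc)
qed

lemma Hammersley_cases:
  assumes "p \<in> Hammersley_sofa"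
  obtains "fst p \<le> - 1/2" "norm (p - (- 1/2, 0)) \<le> 1" "0 \<le> snd p"
    | "- 1/2 \<le> fst p" "fst p \<le> 1/2" "1/2 \<le> snd p" "snd p \<le> 1"
    | "1/2 \<le> fst p" "norm (p - (1/2, 0)) \<le> 1" "0 \<le> snd p"
  using assms unfolding Hammersley_sofa_def quarter_left_def quarter_right_def
  by (auto simp: norm_Pair)

lemma Hammersley_subset_strip: "Hammersley_sofa \<subseteq> horiz_strip"
proof
  fix p assume p: "p \<in> Hammersley_sofa"
  have "snd p \<le> 1" if "norm (p - (a, 0)) \<le> 1" for a
    using norm_snd_le[of "snd p" "fst p - a"] that by (cases p) auto
  then show "p \<in> horiz_strip"
    using p by (elim Hammersley_cases) (auto simp: horiz_strip_iff)
qed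

text \<open>
  Let the hallway of angle \<open>\<alpha>\<close> have its inner corner on the circle of radius 1/2 about the origin, at polar
  angle \<open>2 * \<alpha>\<close>. The outer walls touch the unit circles about \<open>(1/2, 0)\<close> and \<open>(-1/2, 0)\<close>. By
  Thales the lines through the inner walls pass through these two centres, so what the inner corner cuts from
  the upper half plane is a triangle inside the disc of radius 1/2.
\<close>

lemma Hammersley_fits:
  assumes \<alpha>: "0 \<le> \<alpha>" "\<alpha> \<le> pi / 2"
  shows "fits \<alpha> Hammersley_sofa"
proof (rule fits_if_subset_hallway)
  let ?c = "cos \<alpha>" and ?s = "sin \<alpha>"
  have cs: "0 \<le> ?c" "?c \<le> 1" "0 \<le> ?s" "?s \<le> 1" "?s\<^sup>2 + ?c\<^sup>2 = 1"
    using \<alpha> by (auto intro: cos_ge_zero sin_ge_zero)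
  show "Hammersley_sofa \<subseteq> hallway \<alpha> (?c / 2, ?s / 2)"
  proof
    fix p assume p: "p \<in> Hammersley_sofa"
    obtain x y where xy: "p = (x, y)" by (cases p)
    define a where "a = x * ?c + y * ?s"
    define b where "b = - x * ?s + y * ?c"
    have ab: "dir \<alpha> \<bullet> p = a" "dir (\<alpha> + pi / 2) \<bullet> p = b"
      unfolding dir_quarter_inner by (simp_all add: dir_inner a_def b_def xy)
    have unit: "dir \<phi> \<bullet> q \<le> 1" if "norm q \<le> 1" for \<phi> q
      using norm_cauchy_schwarz[of "dir \<phi>" q] that by simp
    have outer: "a \<le> ?c / 2 + 1 \<and> b \<le> ?s / 2 + 1"
      using p
    proof (cases rule: Hammersley_cases)
      case 1
      have "a + ?c / 2 \<le> 1" "b - ?s / 2 \<le> 1"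
        using unit[OF 1(2), of \<alpha>] unit[OF 1(2), of "\<alpha> + pi / 2"] unfolding dir_quarter_inner
        by (simp_all add: dir_inner a_def b_def xy algebra_simps)
      then show ?thesis using cs by simp
    next
      case 2
      have "x * ?c \<le> (1/2) * ?c" "y * ?s \<le> 1 * 1" "(- x) * ?s \<le> (1/2) * ?s" "y * ?c \<le> 1 * 1"
        using 2 cs by (intro mult_mono mult_right_mono; simp add: xy)+
      then show ?thesis by (simp add: a_def b_def)
    next
      case 3
      have "a - ?c / 2 \<le> 1" "b + ?s / 2 \<le> 1"
        using unit[OF 3(2), of \<alpha>] unit[OF 3(2), of "\<alpha> + pi / 2"] unfolding dir_quarter_inner
        by (simp_all add: dir_inner a_def b_def xy algebra_simps)
      then show ?thesis using cs by simp
    qed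
    \<comment> \<open>The sofa avoids the open disc of radius 1/2 and the lower half plane.\<close>
    have radius: "x\<^sup>2 + y\<^sup>2 \<ge> 1/4" and y: "y \<ge> 0"
    proof -
      have "\<bar>x\<bar> \<ge> 1/2 \<or> y \<ge> 1/2" "y \<ge> 0"
        using p by (cases rule: Hammersley_cases; simp add: xy)+
      then have "(1/2)\<^sup>2 \<le> x\<^sup>2 \<or> (1/2)\<^sup>2 \<le> y\<^sup>2"
        unfolding abs_le_square_iff[symmetric] by auto
      moreover have "(1/2)\<^sup>2 = (1/4 :: real)" by (simp add: power2_eq_square)
      ultimately show "x\<^sup>2 + y\<^sup>2 \<ge> 1/4"
        using zero_le_power2[of x] zero_le_power2[of y] by linarith
      show "y \<ge> 0" by fact
    qed
    \<comment> \<open>Otherwise the power of the point with respect to the circle would be negative.\<close>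
    have "?c / 2 \<le> a \<or> ?s / 2 \<le> b"
    proof (rule ccontr)
      assume "\<not> ?thesis"
      then have lt: "a < ?c / 2" "b < ?s / 2" by auto
      have "a * ?s + b * ?c = y * (?s\<^sup>2 + ?c\<^sup>2)" unfolding a_def b_def by algebra
      then have y': "a * ?s + b * ?c \<ge> 0" using y cs by simp
      have "a + ?c / 2 > 0"
      proof (rule ccontr)
        assume "\<not> ?thesis"
        then have "a * ?s \<le> (- ?c / 2) * ?s" using cs by (intro mult_right_mono) auto
        show False
        proof (cases "?c = 0")
          case True
          then have "?s = 1" using cs by (simp add: power2_eq_1_iff)
          then show False using True y' lt by simp
        next
          case False
          then have "b * ?c < ?s / 2 * ?c" using lt cs by (intro mult_strict_right_mono) auto
          then show False using y' \<open>a * ?s \<le> (- ?c / 2) * ?s\<close> by (simp add: mult.commute)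
        qed
      qed
      moreover have "b + ?s / 2 > 0"
      proof (rule ccontr)
        assume "\<not> ?thesis"
        then have "b * ?c \<le> (- ?s / 2) * ?c" using cs by (intro mult_right_mono) auto
        show False
        proof (cases "?s = 0")
          case True
          then have "?c = 1" using cs by (simp add: power2_eq_1_iff)
          then show False using True y' lt by simp
        next
          case False
          then have "a * ?s < ?c / 2 * ?s" using lt cs by (intro mult_strict_right_mono) auto
          then show False using y' \<open>b * ?c \<le> (- ?s / 2) * ?c\<close> by (simp add: mult.commute)
        qed
      qed
      ultimately have "(a + ?c / 2) * (a - ?c / 2) + (b + ?s / 2) * (b - ?s / 2) < 0"
        using lt by (intro add_neg_neg mult_pos_neg) auto
      moreover have "(a + ?c / 2) * (a - ?c / 2) + (b + ?s / 2) * (b - ?s / 2) =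
          a\<^sup>2 + b\<^sup>2 - (?s\<^sup>2 + ?c\<^sup>2) / 4"
      proof -
        have "(t + u / 2) * (t - u / 2) = t\<^sup>2 - u\<^sup>2 / 4" for t u :: real
          by (simp add: power2_eq_square algebra_simps)
        then show ?thesis by (simp only: add_divide_distrib)
      qed
      moreover have "a\<^sup>2 + b\<^sup>2 = (x\<^sup>2 + y\<^sup>2) * (?s\<^sup>2 + ?c\<^sup>2)"
        unfolding a_def b_def by algebra
      ultimately show False using radius cs by simp
    qed
    then show "p \<in> hallway \<alpha> (?c / 2, ?s / 2)"
      using outer by (simp add: hallway_iff ab)
  qed
qed

text \<open>
  The two quarter discs have total area \<open>\<pi>/2\<close> and the rectangle between them has area \<open>1/2\<close>, so
  \<open>\<pi> > 3\<close> suffices. The half disc has half the area of the disc by point reflection.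
\<close>

lemma Hammersley_area: "2 \<le> emeasure lebesgue Hammersley_sofa"
proof -
  let ?m = "measure (lebesgue :: (real \<times> real) measure)"
  let ?half = "cball 0 1 \<inter> UNIV \<times> {0 :: real..} :: (real \<times> real) set"
  let ?box = "box (- 1/2, 1/2) (1/2, 1) :: (real \<times> real) set"
  let ?Q = "(+) (- 1/2, 0) ` quarter_left" and ?R = "(+) (1/2, 0) ` quarter_right"
  have half: "compact ?half" by (intro compact_Int_closed closed_Times) auto
  have reflected: "compact (uminus ` ?half)"
    using half by (intro compact_continuous_image continuous_intros)
  have "pi = ?m (cball 0 1)" using content_cball[of 1 "0 :: real \<times> real"] by (simp add: unit_ball_vol_2)
  also have "\<dots> \<le> ?m (?half \<union> uminus ` ?half)"
  proof (rule measure_mono_fmeasurable)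
    show "cball 0 1 \<subseteq> ?half \<union> uminus ` ?half"
    proof
      fix p :: "real \<times> real" assume "p \<in> cball 0 1"
      then have "p \<in> ?half \<or> - p \<in> ?half" by (auto simp: mem_Times_iff)
      then show "p \<in> ?half \<union> uminus ` ?half"
        using imageI[of "- p" ?half uminus] unfolding minus_minus by (metis UnI1 UnI2)
    qed
    show "cball 0 1 \<in> sets (lebesgue :: (real \<times> real) measure)" by simp
    show "?half \<union> uminus ` ?half \<in> lmeasurable"
      by (intro lmeasurable_compact compact_Un half reflected)
  qed
  also have "\<dots> \<le> ?m ?half + ?m (uminus ` ?half)"
    by (intro measure_Un_le fmeasurableD lmeasurable_compact half reflected)
  also have "?m (uminus ` ?half) = ?m ?half"
    using measure_lebesgue_affine[of "-1" 0 ?half] by simp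
  finally have pi: "pi / 2 \<le> ?m ?half" by simp
  have comp: "compact ?Q" "compact ?R"
    by (intro compact_translation compact_convex_quarters)+
  have "?half = quarter_left \<union> quarter_right"
    unfolding quarter_left_def quarter_right_def by (auto simp del: mem_cball_0)
  then have "?m ?half \<le> ?m quarter_left + ?m quarter_right"
    by (simp only:) (intro measure_Un_le fmeasurableD lmeasurable_compact compact_convex_quarters)
  also have "\<dots> = ?m ?Q + ?m ?R"
    by (simp add: measure_translation)
  finally have QR: "pi / 2 \<le> ?m ?Q + ?m ?R" using pi by simp
  have "?m ?box = (\<Prod>b\<in>Basis. ((1/2, 1) - (- 1/2, 1/2) :: real \<times> real) \<bullet> b)"
    by (subst measure_completion, simp, subst measure_lborel_box) (auto simp: Basis_prod_def)
  then have box: "?m ?box = 1/2" by (simp add: Basis_prod_def)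
  have sets: "?Q \<in> lmeasurable" "?R \<in> lmeasurable" "?box \<in> lmeasurable"
    using comp by (auto intro: lmeasurable_compact)
  have fin: "emeasure lebesgue X \<noteq> \<infinity>" if "X \<in> lmeasurable" for X :: "(real \<times> real) set"
    using fmeasurableD2[OF that] by simp
  have box_bounds: "- 1/2 < fst p" "fst p < 1/2" "1/2 < snd p" "snd p < 1" if "p \<in> ?box" for p
    using that by (auto simp: mem_box Basis_prod_def inner_prod_def)
  have Q_bound: "fst p \<le> - 1/2" if "p \<in> ?Q" for p using that by (auto simp: quarter_left_def)
  have R_bound: "1/2 \<le> fst p" if "p \<in> ?R" for p using that by (auto simp: quarter_right_def)
  have "2 \<le> ?m ?Q + ?m ?box + ?m ?R" using QR box pi_gt3 by simp
  also have "\<dots> = ?m (?Q \<union> ?box \<union> ?R)"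
  proof -
    have disj: "?Q \<inter> ?box = {}" "(?Q \<union> ?box) \<inter> ?R = {}"
    proof -
      show "?Q \<inter> ?box = {}"
        unfolding disjoint_iff using box_bounds Q_bound by (metis not_le)
      have "\<not> 1/2 \<le> fst p" if "p \<in> ?Q \<union> ?box" for p
        using that box_bounds(2)[of p] Q_bound[of p] by (elim UnE) simp_all
      then show "(?Q \<union> ?box) \<inter> ?R = {}"
        unfolding disjoint_iff using R_bound by metis
    qed
    have "?m (?Q \<union> ?box \<union> ?R) = ?m (?Q \<union> ?box) + ?m ?R"
      using sets disj(2) by (intro measure_Union fin fmeasurableD fmeasurable.Un)
    moreover have "?m (?Q \<union> ?box) = ?m ?Q + ?m ?box"
      using sets disj(1) by (intro measure_Union fin fmeasurableD)
    ultimately show ?thesis by simp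
  qed
  also have "\<dots> \<le> ?m Hammersley_sofa"
  proof (rule measure_mono_fmeasurable)
    show "?Q \<union> ?box \<union> ?R \<subseteq> Hammersley_sofa"
    proof -
      have "?box \<subseteq> {- 1/2..1/2} \<times> {1/2..1}"
      proof
        fix p assume "p \<in> ?box"
        from box_bounds[OF this] show "p \<in> {- 1/2..1/2} \<times> {1/2..1}" by (simp add: mem_Times_iff)
      qed
      then show ?thesis unfolding Hammersley_sofa_def by (intro Un_mono order_refl)
    qed
    show "?Q \<union> ?box \<union> ?R \<in> sets lebesgue"
      using sets by (intro fmeasurableD fmeasurable.Un)
  qed (rule lmeasurable_compact[OF compact_Hammersley])
  finally have "ennreal 2 \<le> ennreal (?m Hammersley_sofa)" by (rule ennreal_leI)
  then show ?thesis
    using lmeasurable_compact[OF compact_Hammersley] by (simp add: emeasure_eq_measure2)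
qed

lemma two_le_W:
  assumes "n \<ge> 3"
  shows "2 \<le> W n"
proof -
  have "emeasure lebesgue Hammersley_sofa \<le> W n"
  proof (rule emeasure_le_W)
    show "Hammersley_sofa \<noteq> {}" using Hammersley_area by auto
    show "1 \<in> {1..nat \<lceil>real n / 3\<rceil>}" using assms by (simp add: le_nat_iff one_le_ceiling)
    show "fits \<alpha> Hammersley_sofa" if "\<alpha> \<in> set (angles n 1)" for \<alpha>
      using angles_bounds[OF that] by (intro Hammersley_fits)
    show "Hammersley_sofa \<subseteq> butterfly (gamma1 n 1) (gamma2 n 1)"
      using Hammersley_subset_strip butterfly_one_eq[of n] assms by auto
  qed (rule compact_Hammersley connected_Hammersley Hammersley_subset_strip)+
  then show ?thesis using Hammersley_area by (rule order_trans[rotated])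
qed

lemma mu_MS_le_W:
  assumes "n \<ge> 3"
  shows "mu_MS \<le> W n"
  unfolding mu_MS_def
proof (rule SUP_least)
  fix S assume "S \<in> {S. moving_sofa S}"
  then obtain T \<beta> where T: "T \<noteq> {}" "compact T" "connected T" "T \<subseteq> horiz_strip"
    "emeasure lebesgue T = emeasure lebesgue S"
    and fits: "\<And>\<alpha>. \<alpha> \<in> closed_segment 0 \<beta> \<Longrightarrow> fits \<alpha> T"
    and width: "\<And>p q. p \<in> T \<Longrightarrow> q \<in> T \<Longrightarrow> dir \<beta> \<bullet> (p - q) \<le> 1"
    using moving_sofa_normalised by auto
  have "emeasure lebesgue T \<le> W n"
  proof (cases "\<beta> \<le> pi / 3")
    case True
    then have "emeasure lebesgue T \<le> 2"
      using T fits width by (intro emeasure_le_2_if_small_turn) auto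
    then show ?thesis using two_le_W[OF assms] by (rule order_trans)
  next
    case False
    show ?thesis
    proof (rule emeasure_le_W_if_turn[OF assms T(1-4)])
      show "fits \<alpha> T" if "0 \<le> \<alpha>" "\<alpha> \<le> \<beta>" for \<alpha>
        using that by (intro fits) (auto simp: closed_segment_eq_real_ivl)
    qed (use False width in auto)
  qed
  then show "emeasure lebesgue S \<le> W n" using T(5) by simp
qed

section \<open>Limits of compact connected sets\<close>

text \<open>
  The distance functions of the sets are 1-Lipschitz and uniformly bounded, so Arzela-Ascoli
  gives a subsequence that converges uniformly on \<open>K\<close>; the limit set is the zero set of the limit
  function. Uniformity yields the last conclusion, that the sets are eventually inside
  every neighbourhood of the limit. Two separated pieces of the limit would
  then split almost all of the sets, which is why connectedness survives.
\<close>

lemma Blaschke_selection: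
  fixes C :: "nat \<Rightarrow> 'a::euclidean_space set"
  assumes K: "compact K"
    and C: "\<And>n. C n \<noteq> {}" "\<And>n. closed (C n)" "\<And>n. connected (C n)" "\<And>n. C n \<subseteq> K"
  obtains S r where "strict_mono r" "compact S" "S \<noteq> {}" "connected S" "S \<subseteq> K"
    "\<And>p. p \<in> S \<Longrightarrow> \<exists>x. (\<forall>n. x n \<in> C (r n)) \<and> x \<longlonglongrightarrow> p"
    "\<And>U. open U \<Longrightarrow> S \<subseteq> U \<Longrightarrow> \<forall>\<^sub>F n in sequentially. C (r n) \<subseteq> U"
proof -
  let ?d = "\<lambda>n p. infdist p (C n)"
  obtain k where k: "k \<in> C 0" using C(1)[of 0] by blast
  have bd: "norm (?d n x) \<le> diameter K" if "x \<in> K" for n x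
  proof -
    obtain c where c: "c \<in> C n" using C(1) by blast
    have "?d n x \<le> dist x c" using c by (rule infdist_le)
    also have "\<dots> \<le> diameter K"
      using c C(4) that K by (intro diameter_bounded_bound) (auto simp: compact_imp_bounded)
    finally show ?thesis by (simp add: infdist_nonneg)
  qed
  obtain g r where g: "continuous_on K g" and r: "strict_mono (r :: nat \<Rightarrow> nat)"
    and lim: "\<And>e. 0 < e \<Longrightarrow> \<exists>N. \<forall>n x. n \<ge> N \<and> x \<in> K \<longrightarrow> norm (?d (r n) x - g x) < e"
  proof (rule Arzela_Ascoli[OF K bd])
    show "\<exists>d>0. \<forall>n y. y \<in> K \<and> norm (x - y) < d \<longrightarrow> norm (?d n x - ?d n y) < e" if "e > 0" for x e
    proof (intro exI[of _ e] conjI allI impI that)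
      fix n y assume y: "y \<in> K \<and> norm (x - y) < e"
      show "norm (?d n x - ?d n y) < e"
        using y infdist_triangle_abs[of x "C n" y] by (simp add: dist_norm)
    qed
  next
    fix g k
    assume "continuous_on K g" "strict_mono (k :: nat \<Rightarrow> nat)"
      "\<And>e. 0 < e \<Longrightarrow> \<exists>N. \<forall>n x. n \<ge> N \<and> x \<in> K \<longrightarrow> norm (?d (k n) x - g x) < e"
    then show thesis by (rule that)
  qed
  have ptw: "(\<lambda>n. ?d (r n) x) \<longlonglongrightarrow> g x" if "x \<in> K" for x
    using lim that by (intro LIMSEQ_I) blast
  have g0: "g x \<ge> 0" if "x \<in> K" for x
    using ptw[OF that] by (rule LIMSEQ_le_const) (auto simp: infdist_nonneg)
  have near: "\<forall>\<^sub>F n in sequentially. C (r n) \<inter> A = {}"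
    if A: "compact A" "A \<subseteq> K" "\<And>x. x \<in> A \<Longrightarrow> g x > 0" for A
  proof (cases "A = {}")
    case False
    obtain m where m: "m \<in> A" "\<And>x. x \<in> A \<Longrightarrow> g m \<le> g x"
      using continuous_attains_inf[OF A(1) False continuous_on_subset[OF g A(2)]] by blast
    obtain N where N: "\<And>n x. n \<ge> N \<Longrightarrow> x \<in> K \<Longrightarrow> norm (?d (r n) x - g x) < g m"
      using lim[OF A(3)[OF m(1)]] by blast
    have "C (r n) \<inter> A = {}" if "n \<ge> N" for n
    proof (rule ccontr)
      assume "C (r n) \<inter> A \<noteq> {}"
      then obtain x where x: "x \<in> C (r n)" "x \<in> A" by blast
      then have "norm (?d (r n) x - g x) < g m" using N[OF that] A(2) by blast
      then show False using m(2)[OF x(2)] x(1) by simp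
    qed
    then show ?thesis by (auto simp: eventually_sequentially)
  qed auto
  define S where "S = {x \<in> K. g x = 0}"
  have "closed S" unfolding S_def
    by (intro continuous_closed_preimage_constant g compact_imp_closed K)
  then have S: "compact S" "S \<subseteq> K"
    using K by (auto simp: S_def compact_eq_bounded_closed intro: bounded_subset)
  have U: "\<forall>\<^sub>F n in sequentially. C (r n) \<subseteq> U" if "open U" "S \<subseteq> U" for U
  proof -
    have "\<forall>\<^sub>F n in sequentially. C (r n) \<inter> (K - U) = {}"
    proof (rule near)
      show "compact (K - U)" using K that(1) by (rule compact_diff)
      show "g x > 0" if "x \<in> K - U" for x
        using that \<open>S \<subseteq> U\<close> g0[of x] by (force simp: S_def)
    qed auto
    then show ?thesis by (rule eventually_mono) (use C(4) in blast)
  qed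
  have "S \<noteq> {}"
  proof
    assume "S = {}"
    then obtain n where "C (r n) \<subseteq> {}" using U[of "{}"] by (auto simp: eventually_sequentially)
    then show False using C(1) by blast
  qed
  have approx: "\<exists>x. (\<forall>n. x n \<in> C (r n)) \<and> x \<longlonglongrightarrow> p" if p: "p \<in> S" for p
  proof -
    have "\<exists>y\<in>C (r n). infdist p (C (r n)) = dist p y" for n
      using infdist_attains_inf[OF C(2,1), of "r n" p] by blast
    then obtain x where x: "\<And>n. x n \<in> C (r n)" "\<And>n. infdist p (C (r n)) = dist p (x n)"
      by metis
    have "(\<lambda>n. dist (x n) p) \<longlonglongrightarrow> 0"
      using ptw[of p] p x(2) by (simp add: S_def dist_commute)
    then show ?thesis using x(1) tendsto_dist_iff by blast
  qed
  have "connected S"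
  proof (rule ccontr)
    assume "\<not> connected S"
    then obtain A B where AB: "closedin (top_of_set S) A" "closedin (top_of_set S) B"
      "A \<union> B = S" "A \<inter> B = {}" "A \<noteq> {}" "B \<noteq> {}"
      unfolding connected_closedin_eq by blast
    have "closed A" "closed B" using AB S \<open>closed S\<close> closedin_closed_trans by blast+
    obtain V W where VW: "open V" "open W" "A \<subseteq> V" "B \<subseteq> W" "V \<inter> W = {}"
      using separation_normal[OF \<open>closed A\<close> \<open>closed B\<close> AB(4)] by blast
    obtain a b where ab: "a \<in> A" "b \<in> B" using AB by blast
    obtain x where x: "\<And>n. x n \<in> C (r n)" "x \<longlonglongrightarrow> a" using approx ab AB by blast
    obtain y where y: "\<And>n. y n \<in> C (r n)" "y \<longlonglongrightarrow> b" using approx ab AB by blast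
    have "\<forall>\<^sub>F n in sequentially. x n \<in> V"
      using topological_tendstoD[OF x(2) VW(1)] ab VW by blast
    moreover have "\<forall>\<^sub>F n in sequentially. y n \<in> W"
      using topological_tendstoD[OF y(2) VW(2)] ab VW by blast
    moreover have "\<forall>\<^sub>F n in sequentially. C (r n) \<subseteq> V \<union> W"
      using VW AB by (intro U) auto
    ultimately have "\<forall>\<^sub>F n in sequentially. False"
    proof eventually_elim
      case (elim n)
      show False
        using connectedD[OF C(3) VW(1,2), of "r n"] elim VW(5) x(1)[of n] y(1)[of n] by blast
    qed
    then show False by simp
  qed
  with that[of r S] r S U approx \<open>S \<noteq> {}\<close> show thesis by blast
qed

text \<open>
  Outer regularity. Together with the last conclusion of \<open>Blaschke_selection\<close> this is the upper
  semicontinuity of area.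
\<close>

lemma le_emeasure_if_le_open_supersets:
  fixes S :: "'a::euclidean_space set"
  assumes S: "S \<in> sets lebesgue"
    and le: "\<And>U. open U \<Longrightarrow> S \<subseteq> U \<Longrightarrow> c \<le> emeasure lebesgue U"
  shows "c \<le> emeasure lebesgue S"
proof (rule ennreal_le_epsilon)
  fix e :: real assume "e > 0"
  obtain T where T: "open T" "S \<subseteq> T" "T - S \<in> lmeasurable" "emeasure lebesgue (T - S) < ennreal e"
    using sets_lebesgue_outer_open[OF S \<open>e > 0\<close>] .
  have "c \<le> emeasure lebesgue (S \<union> (T - S))" using le[OF T(1,2)] T(2) by (simp add: Un_absorb1)
  also have "\<dots> \<le> emeasure lebesgue S + emeasure lebesgue (T - S)"
    using S T(3) by (intro emeasure_subadditive) auto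
  also have "\<dots> \<le> emeasure lebesgue S + ennreal e"
    using T(4) by (intro add_left_mono) auto
  finally show "c \<le> emeasure lebesgue S + ennreal e" .
qed

section \<open>Limits of components of the discrete regions\<close>

text \<open>
  Each leg of the hallway meets the strip in a parallelogram of horizontal extent at most 4. A
  connected set that extends over more than 8 has three points whose first coordinates differ pairwise by
  more than 4, and two of them lie in the same leg.
\<close>

lemma fst_diff_le_8_if_hallway:
  assumes C: "connected C" "C \<subseteq> horiz_strip" "C \<subseteq> hallway \<alpha> u"
    and \<alpha>: "1/2 \<le> cos \<alpha>" "1/2 \<le> sin \<alpha>"
    and pq: "p \<in> C" "q \<in> C"
  shows "fst q - fst p \<le> 8"
proof (rule ccontr)
  assume far: "\<not> fst q - fst p \<le> 8"
  have "connected (fst ` C)" using C(1) by (intro connected_continuous_image continuous_intros)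
  then have "(fst p + fst q) / 2 \<in> fst ` C"
    using connectedD_interval[of "fst ` C" "fst p" "fst q"] pq far by auto
  then obtain r where r: "r \<in> C" "fst r = (fst p + fst q) / 2" by auto
  let ?V = "\<lambda>z. fst u \<le> dir \<alpha> \<bullet> z \<and> dir \<alpha> \<bullet> z \<le> fst u + 1"
  let ?H = "\<lambda>z. snd u \<le> dir (\<alpha> + pi / 2) \<bullet> z \<and> dir (\<alpha> + pi / 2) \<bullet> z \<le> snd u + 1"
  have leg: "?V z \<or> ?H z" and strip: "0 \<le> snd z" "snd z \<le> 1" if "z \<in> C" for z
    using C(2,3) that by (auto simp: hallway_iff horiz_strip_iff)
  have close: "fst z' - fst z \<le> 4" if z: "z \<in> C" "z' \<in> C" "?V z \<and> ?V z' \<or> ?H z \<and> ?H z'" for z z'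
  proof (rule ccontr)
    assume far: "\<not> fst z' - fst z \<le> 4"
    define d e where "d = fst z' - fst z" and "e = snd z' - snd z"
    have d: "d > 4" using far by (simp add: d_def)
    have large: "d * (1/2) \<le> d * cos \<alpha>" "d * (1/2) \<le> d * sin \<alpha>"
      using d \<alpha> by (intro mult_left_mono; simp)+
    have "\<bar>e\<bar> \<le> 1" using strip[OF z(1)] strip[OF z(2)] by (auto simp: e_def)
    then have "\<bar>e * sin \<alpha>\<bar> \<le> 1" "\<bar>e * cos \<alpha>\<bar> \<le> 1"
      unfolding abs_mult by (auto intro!: mult_le_one)
    then have small: "- 1 \<le> e * sin \<alpha>" "e * cos \<alpha> \<le> 1" by linarith+
    have "dir \<alpha> \<bullet> (z' - z) \<le> 1 \<or> - 1 \<le> dir (\<alpha> + pi / 2) \<bullet> (z' - z)"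
      using z(3) by (auto simp: inner_diff_right)
    then have "d * cos \<alpha> + e * sin \<alpha> \<le> 1 \<or> - 1 \<le> - (d * sin \<alpha>) + e * cos \<alpha>"
      unfolding dir_quarter_inner by (auto simp: dir_inner d_def e_def algebra_simps)
    then show False using large small d by linarith
  qed
  have "fst r - fst p > 4" "fst q - fst r > 4" "fst q - fst p > 4" using far r(2) by auto
  then show False
    using leg[OF pq(1)] leg[OF pq(2)] leg[OF r(1)]
      close[OF pq(1) r(1)] close[OF r(1) pq(2)] close[OF pq] by linarith
qed

text \<open>
  The angle in the middle of the quarter turn, between 30 and 45 degrees; its hallway bounds the extent of
  a component independently of \<open>n\<close>.
\<close>

lemma angles_mid:
  assumes n: "n \<ge> 12" and k: "k \<in> {1..nat \<lceil>real n / 3\<rceil>}"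
  obtains \<alpha> where "\<alpha> \<in> set (angles n k)" "1/2 \<le> cos \<alpha>" "1/2 \<le> sin \<alpha>"
proof -
  define j where "j = n div 2"
  define \<alpha> where "\<alpha> = real j / real n * (pi / 2)"
  have "real k < real n / 3 + 1" using k by simp linarith
  then have "3 * k < n + 3" by linarith
  then have j: "1 \<le> j" "j < n - k" "2 * j \<le> n" "n \<le> 3 * j" using n by (auto simp: j_def)
  then have "\<alpha> \<in> set (angles n k)" by (auto simp: angles_def \<alpha>_def)
  moreover have jn: "1/3 \<le> real j / real n" "real j / real n \<le> 1/2"
    using j n by (simp_all add: field_simps)
  have "1/3 * (pi / 2) \<le> \<alpha>" "\<alpha> \<le> 1/2 * (pi / 2)"
    unfolding \<alpha>_def using jn by (intro mult_right_mono; simp)+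
  then have "pi / 6 \<le> \<alpha>" "\<alpha> \<le> pi / 3" using pi_gt_zero by linarith+
  moreover from this have "1/2 \<le> sin \<alpha>" 
    using sin_monotone_2pi_le[of "pi / 6" \<alpha>] by (simp add: sin_30)
  moreover have "1/2 \<le> cos \<alpha>" using \<open>pi / 6 \<le> \<alpha>\<close> \<open>\<alpha> \<le> pi / 3\<close> by (intro cos_ge_half) auto
  ultimately show thesis using that by blast
qed

lemma fits_limit:
  assumes a: "a \<longlonglongrightarrow> \<alpha>" and fits: "\<And>i. fits (a i) (D i)"
    and approx: "\<And>p. p \<in> S \<Longrightarrow> \<exists>x. (\<forall>i. x i \<in> D i) \<and> x \<longlonglongrightarrow> p"
  shows "fits \<alpha> S"
  unfolding fits_def
proof (intro ballI)
  fix p q r assume "p \<in> S" "q \<in> S" "r \<in> S"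
  then obtain x y z where x: "\<And>i. x i \<in> D i" "x \<longlonglongrightarrow> p" and y: "\<And>i. y i \<in> D i" "y \<longlonglongrightarrow> q"
    and z: "\<And>i. z i \<in> D i" "z \<longlonglongrightarrow> r"
    using approx by metis
  have "(\<lambda>i. min (dir (a i) \<bullet> (y i - x i)) (dir (a i + pi / 2) \<bullet> (z i - x i)))
      \<longlonglongrightarrow> min (dir \<alpha> \<bullet> (q - p)) (dir (\<alpha> + pi / 2) \<bullet> (r - p))"
    by (intro tendsto_intros a x(2) y(2) z(2))
  moreover have "min (dir (a i) \<bullet> (y i - x i)) (dir (a i + pi / 2) \<bullet> (z i - x i)) \<le> 1" for i
    using fits[of i] x(1) y(1) z(1) unfolding fits_def min_le_iff_disj by blast
  ultimately have "min (dir \<alpha> \<bullet> (q - p)) (dir (\<alpha> + pi / 2) \<bullet> (r - p)) \<le> 1"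
    by (intro LIMSEQ_le_const2) auto
  then show "dir \<alpha> \<bullet> (q - p) \<le> 1 \<or> dir (\<alpha> + pi / 2) \<bullet> (r - p) \<le> 1"
    by (simp add: min_le_iff_disj)
qed

lemma angles_dense:
  assumes N: "filterlim N at_top sequentially" and K: "\<And>i. K i + 2 \<le> N i"
    and \<kappa>: "(\<lambda>i. real (K i) / real (N i)) \<longlonglongrightarrow> \<kappa>"
    and \<alpha>: "0 \<le> \<alpha>" "\<alpha> \<le> (1 - \<kappa>) * (pi / 2)"
  obtains a where "\<And>i. a i \<in> set (angles (N i) (K i))" "a \<longlonglongrightarrow> \<alpha>"
proof -
  define x where "x = \<alpha> / (pi / 2)"
  have x: "0 \<le> x" "x \<le> 1 - \<kappa>" "\<alpha> = x * (pi / 2)"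
    using \<alpha> pi_gt_zero by (auto simp: x_def field_simps)
  \<comment> \<open>Round down, and clamp to the valid indices; in the limit the clamping has no effect.\<close>
  define j where "j i = max 1 (min (N i - K i - 1) (nat \<lfloor>real (N i) * x\<rfloor>))" for i
  have Npos: "real (N i) > 0" for i using K[of i] by simp
  have inv: "(\<lambda>i. 1 / real (N i)) \<longlonglongrightarrow> 0"
    by (intro tendsto_divide_0[OF tendsto_const] filterlim_at_top_imp_at_infinity
        filterlim_compose[OF filterlim_real_sequentially N])
  have floor: "(\<lambda>i. real (nat \<lfloor>real (N i) * x\<rfloor>) / real (N i)) \<longlonglongrightarrow> x"
  proof (rule tendsto_sandwich)
    show "\<forall>\<^sub>F i in sequentially. x - 1 / real (N i) \<le> real (nat \<lfloor>real (N i) * x\<rfloor>) / real (N i)"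
    proof (intro always_eventually allI)
      fix i
      have "x - 1 / real (N i) = (real (N i) * x - 1) / real (N i)"
        using Npos[of i] by (simp add: field_simps)
      also have "\<dots> \<le> real (nat \<lfloor>real (N i) * x\<rfloor>) / real (N i)"
        using Npos[of i] by (intro divide_right_mono) linarith+
      finally show "x - 1 / real (N i) \<le> real (nat \<lfloor>real (N i) * x\<rfloor>) / real (N i)" .
    qed
    show "\<forall>\<^sub>F i in sequentially. real (nat \<lfloor>real (N i) * x\<rfloor>) / real (N i) \<le> x"
    proof (intro always_eventually allI)
      fix i
      have "real (nat \<lfloor>real (N i) * x\<rfloor>) \<le> real (N i) * x" using x(1) by simp
      then show "real (nat \<lfloor>real (N i) * x\<rfloor>) / real (N i) \<le> x"
        using Npos[of i] by (simp add: field_simps)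
    qed
    show "(\<lambda>i. x - 1 / real (N i)) \<longlonglongrightarrow> x" using tendsto_diff[OF tendsto_const inv, of x] by simp
  qed simp
  have "real (j i) / real (N i) = max (1 / real (N i))
      (min (1 - real (K i) / real (N i) - 1 / real (N i)) (real (nat \<lfloor>real (N i) * x\<rfloor>) / real (N i)))" for i
  proof -
    have "real (N i - K i - 1) = real (N i) - real (K i) - 1" using K[of i] by simp
    then have "1 - real (K i) / real (N i) - 1 / real (N i) = real (N i - K i - 1) / real (N i)"
      using Npos[of i] by (simp add: field_simps)
    then show ?thesis
      using Npos[of i] unfolding j_def of_nat_max of_nat_min
      by (simp add: max_divide_distrib_right min_divide_distrib_right)
  qed
  moreover have "(\<lambda>i. max (1 / real (N i))
      (min (1 - real (K i) / real (N i) - 1 / real (N i)) (real (nat \<lfloor>real (N i) * x\<rfloor>) / real (N i))))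
      \<longlonglongrightarrow> max 0 (min (1 - \<kappa> - 0) x)"
    by (intro tendsto_intros inv floor \<kappa>)
  ultimately have "(\<lambda>i. real (j i) / real (N i)) \<longlonglongrightarrow> x" using x by simp
  then have "(\<lambda>i. real (j i) / real (N i) * (pi / 2)) \<longlonglongrightarrow> \<alpha>"
    unfolding x(3) by (intro tendsto_intros)
  moreover have "real (j i) / real (N i) * (pi / 2) \<in> set (angles (N i) (K i))" for i
  proof -
    have "j i \<in> set [1..<N i - K i]" using K[of i] by (auto simp: j_def)
    then show ?thesis unfolding angles_def set_map by (rule imageI)
  qed
  ultimately show thesis using that[of "\<lambda>i. real (j i) / real (N i) * (pi / 2)"] by simp
qed

text \<open>
  Each half of the butterfly bounds the product with one of the two directions from below by 0 and
  the product with the other one from above by 1. Exchanging the directions costs \<open>norm (dir b\<^sub>1 - dir b\<^sub>2)\<close> times the size of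
  the point, which is at most \<open>1 / cos b\<^sub>2 + 1\<close>.
\<close>

lemma butterfly_width:
  assumes b: "0 \<le> b\<^sub>1" "b\<^sub>1 \<le> b\<^sub>2" "b\<^sub>2 < pi / 2"
    and p: "p \<in> horiz_strip \<inter> butterfly b\<^sub>1 b\<^sub>2" and q: "q \<in> horiz_strip \<inter> butterfly b\<^sub>1 b\<^sub>2"
  shows "dir b\<^sub>1 \<bullet> (p - q) \<le> 1 + 2 * (norm (dir b\<^sub>1 - dir b\<^sub>2) * (1 / cos b\<^sub>2 + 1))"
proof -
  define \<delta> where "\<delta> = norm (dir b\<^sub>1 - dir b\<^sub>2) * (1 / cos b\<^sub>2 + 1)"
  have cos: "0 < cos b\<^sub>2" "cos b\<^sub>2 \<le> cos b\<^sub>1"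
    using b by (auto intro!: cos_gt_zero_pi cos_monotone_0_pi_le)
  have sin: "0 \<le> sin b\<^sub>1" "0 \<le> sin b\<^sub>2" "sin b\<^sub>1 \<le> 1" "sin b\<^sub>2 \<le> 1"
    using b by (auto intro!: sin_ge_zero)
  have bound: "- \<delta> \<le> dir b\<^sub>1 \<bullet> z \<and> dir b\<^sub>1 \<bullet> z \<le> 1 + \<delta>" if z: "z \<in> horiz_strip \<inter> butterfly b\<^sub>1 b\<^sub>2" for z
  proof -
    have y: "0 \<le> snd z" "snd z \<le> 1" using z by (auto simp: horiz_strip_iff)
    have ys: "0 \<le> snd z * sin b\<^sub>1" "snd z * sin b\<^sub>1 \<le> 1" "0 \<le> snd z * sin b\<^sub>2" "snd z * sin b\<^sub>2 \<le> 1"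
      using y sin by (auto intro: mult_le_one)
    have lower: "- 1 \<le> fst z * cos b\<^sub>2"
    proof (cases "fst z \<ge> 0")
      case True
      then show ?thesis using cos by (smt (verit) mult_nonneg_nonneg)
    next
      case False
      then have "fst z * cos b\<^sub>1 \<le> fst z * cos b\<^sub>2" using cos by (intro mult_left_mono_neg) auto
      then show ?thesis using z ys by (auto simp: butterfly_iff dir_inner)
    qed
    have upper: "fst z * cos b\<^sub>2 \<le> 1"
    proof (cases "fst z \<ge> 0")
      case True
      then have "fst z * cos b\<^sub>2 \<le> fst z * cos b\<^sub>1" using cos by (intro mult_left_mono) auto
      then show ?thesis using z ys by (auto simp: butterfly_iff dir_inner)
    next
      case False
      then show ?thesis using cos by (smt (verit) mult_nonneg_nonneg mult_minus_left)
    qed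
    have "\<bar>fst z\<bar> \<le> 1 / cos b\<^sub>2" using lower upper cos by (simp add: abs_le_iff field_simps)
    then have "norm z \<le> 1 / cos b\<^sub>2 + 1"
      using y norm_triangle_le[of "fst z" "snd z"] norm_Pair_le[of "fst z" "snd z"] by simp
    then have "\<bar>(dir b\<^sub>1 - dir b\<^sub>2) \<bullet> z\<bar> \<le> \<delta>"
      unfolding \<delta>_def using Cauchy_Schwarz_ineq2 mult_left_mono norm_ge_zero order_trans by meson
    then show ?thesis using z unfolding inner_diff_left by (auto simp: butterfly_iff)
  qed
  show ?thesis using bound[OF p] bound[OF q] unfolding inner_diff_right \<delta>_def by linarith
qed

lemma discrete_region_subset: "discrete_region n k u \<subseteq> horiz_strip \<inter> butterfly (gamma1 n k) (gamma2 n k)"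
  unfolding discrete_region_def by blast

lemma subset_hallway_if_discrete_region:
  assumes "C \<subseteq> discrete_region n k u" "\<alpha> \<in> set (angles n k)"
  obtains v where "C \<subseteq> hallway \<alpha> v"
proof -
  obtain j where "j < length (angles n k)" "\<alpha> = angles n k ! j"
    using assms(2) by (metis in_set_conv_nth)
  then have "C \<subseteq> hallway \<alpha> (u j)" using assms(1) unfolding discrete_region_def by blast
  then show thesis by (rule that)
qed

text \<open>
  Along a subsequence the ratios of \<open>K i\<close> to \<open>N i\<close> converge to some \<open>\<kappa>\<close>, so that both butterfly angles tend to
  \<open>\<beta> = (1 - \<kappa>) * (\<pi>/2)\<close>. Translating the components horizontally makes them bounded; it changes
  neither their area nor the condition \<open>fits\<close> nor widths.
\<close>

lemma le_mu_MS_if_components: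
  fixes N K :: "nat \<Rightarrow> nat"
  assumes N: "filterlim N at_top sequentially" "\<And>i. N i \<ge> 12"
    and K: "\<And>i. K i \<in> {1..nat \<lceil>real (N i) / 3\<rceil>}"
    and C: "\<And>i. C i \<in> components (discrete_region (N i) (K i) (u i))"
    and c: "\<And>i. c \<le> emeasure lebesgue (C i)"
  shows "c \<le> mu_MS"
proof -
  have sub: "C i \<subseteq> discrete_region (N i) (K i) (u i)" for i using C in_components_subset by blast
  have Cne: "C i \<noteq> {}" and Cconn: "connected (C i)" for i
    using C in_components_nonempty in_components_connected by blast+
  have Cclosed: "closed (C i)" for i using C closed_components closed_discrete_region by blast
  have K3: "3 * K i < N i + 3" for i
  proof -
    have "real (K i) < real (N i) / 3 + 1" using K[of i] by simp linarith
    then show ?thesis by linarith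
  qed
  define \<rho> where "\<rho> i = real (K i) / real (N i)" for i
  have "\<rho> i \<in> {0..1}" for i
    using K3[of i] N(2)[of i] by (simp add: \<rho>_def field_simps)
  then have "\<exists>l\<in>{0..1}. \<exists>r :: nat \<Rightarrow> nat. strict_mono r \<and> (\<rho> \<circ> r) \<longlonglongrightarrow> l"
    using spec[OF compact_Icc[of 0 "1 :: real", unfolded compact_def], of \<rho>] by blast
  then obtain \<kappa> r\<^sub>1 where \<kappa>: "\<kappa> \<in> {0..1}" and r\<^sub>1: "strict_mono (r\<^sub>1 :: nat \<Rightarrow> nat)"
    and lim\<^sub>1: "(\<rho> \<circ> r\<^sub>1) \<longlonglongrightarrow> \<kappa>"
    by blast
  have "\<forall>i. \<exists>p. p \<in> C i" using Cne by blast
  then obtain x where x: "\<And>i. x i \<in> C i" by metis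
  define D where "D i = (+) (- fst (x (r\<^sub>1 i)), 0) ` C (r\<^sub>1 i)" for i
  have D_box: "D i \<subseteq> {-8..8} \<times> {0..1}" for i
  proof
    fix p assume "p \<in> D i"
    then obtain q where q: "q \<in> C (r\<^sub>1 i)" "p = (- fst (x (r\<^sub>1 i)), 0) + q" by (auto simp: D_def)
    obtain \<alpha> where \<alpha>: "\<alpha> \<in> set (angles (N (r\<^sub>1 i)) (K (r\<^sub>1 i)))" "1/2 \<le> cos \<alpha>" "1/2 \<le> sin \<alpha>"
      using angles_mid[OF N(2) K] .
    obtain v where v: "C (r\<^sub>1 i) \<subseteq> hallway \<alpha> v" using subset_hallway_if_discrete_region[OF sub \<alpha>(1)] .
    have strip: "C (r\<^sub>1 i) \<subseteq> horiz_strip" using sub discrete_region_subset by blast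
    have "fst q - fst (x (r\<^sub>1 i)) \<le> 8" "fst (x (r\<^sub>1 i)) - fst q \<le> 8"
      using fst_diff_le_8_if_hallway[OF Cconn strip v \<alpha>(2,3)] x q(1) by blast+
    moreover have "0 \<le> snd q" "snd q \<le> 1" using q(1) strip by (auto simp: horiz_strip_iff)
    ultimately show "p \<in> {-8..8} \<times> {0..1}" by (simp add: q(2) mem_Times_iff)
  qed
  have box: "compact ({-8..8} \<times> {0..1} :: (real \<times> real) set)" by (intro compact_Times compact_Icc)
  have D: "D i \<noteq> {}" "closed (D i)" "connected (D i)" for i
    unfolding D_def using Cne Cclosed Cconn by (auto intro: closed_translation connected_translate)
  obtain S r\<^sub>2 where r\<^sub>2: "strict_mono r\<^sub>2" and S: "compact S" "S \<noteq> {}" "connected S" "S \<subseteq> {-8..8} \<times> {0..1}"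
    and approx: "\<And>p. p \<in> S \<Longrightarrow> \<exists>x. (\<forall>i. x i \<in> D (r\<^sub>2 i)) \<and> x \<longlonglongrightarrow> p"
    and absorb: "\<And>U. open U \<Longrightarrow> S \<subseteq> U \<Longrightarrow> \<forall>\<^sub>F i in sequentially. D (r\<^sub>2 i) \<subseteq> U"
    by (rule Blaschke_selection[OF box D D_box]) (rule that)
  define r where "r = r\<^sub>1 \<circ> r\<^sub>2"
  have r: "strict_mono r" unfolding r_def using r\<^sub>1 r\<^sub>2 by (rule strict_mono_o)
  have Nr: "filterlim (\<lambda>i. N (r i)) at_top sequentially"
    using filterlim_compose[OF N(1) filterlim_subseq[OF r]] .
  have Kr: "(\<lambda>i. real (K (r i)) / real (N (r i))) \<longlonglongrightarrow> \<kappa>"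
    using LIMSEQ_subseq_LIMSEQ[OF lim\<^sub>1 r\<^sub>2] by (simp add: o_def r_def \<rho>_def)
  define \<beta> where "\<beta> = (1 - \<kappa>) * (pi / 2)"
  have Npos: "real (N i) > 0" for i using N(2)[of i] by simp
  have g1: "gamma1 (N i) (K i) = (1 - real (K i) / real (N i)) * (pi / 2)" for i
    using Npos[of i] by (simp add: gamma1_def field_simps)
  have g2: "gamma2 (N i) (K i) = (1 - real (K i) / real (N i) + 1 / real (N i)) * (pi / 2)" for i
    using Npos[of i] by (simp add: gamma2_def field_simps)
  have inv: "(\<lambda>i. 1 / real (N (r i))) \<longlonglongrightarrow> 0"
    by (intro tendsto_divide_0[OF tendsto_const] filterlim_at_top_imp_at_infinity
        filterlim_compose[OF filterlim_real_sequentially Nr])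
  have lim_g1: "(\<lambda>i. gamma1 (N (r i)) (K (r i))) \<longlonglongrightarrow> \<beta>"
    unfolding g1 \<beta>_def by (intro tendsto_intros Kr)
  have "(\<lambda>i. gamma2 (N (r i)) (K (r i))) \<longlonglongrightarrow> (1 - \<kappa> + 0) * (pi / 2)"
    unfolding g2 by (intro tendsto_intros Kr inv)
  then have lim_g2: "(\<lambda>i. gamma2 (N (r i)) (K (r i))) \<longlonglongrightarrow> \<beta>" by (simp add: \<beta>_def)
  have D_r: "D (r\<^sub>2 i) = (+) (- fst (x (r i)), 0) ` C (r i)" for i by (simp add: D_def r_def)
  have "moving_sofa S"
  proof (rule moving_sofa_if_fits)
    show strip: "S \<subseteq> horiz_strip" using S(4) by (auto simp: horiz_strip_def)
    show "0 \<le> \<beta>" using \<kappa> by (simp add: \<beta>_def)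
    show "fits \<alpha> S" if \<alpha>: "0 \<le> \<alpha>" "\<alpha> \<le> \<beta>" for \<alpha>
    proof -
      have "K (r i) + 2 \<le> N (r i)" for i using K3[of "r i"] N(2)[of "r i"] by linarith
      then obtain a where a: "\<And>i. a i \<in> set (angles (N (r i)) (K (r i)))" "a \<longlonglongrightarrow> \<alpha>"
        using angles_dense[OF Nr _ Kr \<alpha>(1) \<alpha>(2)[unfolded \<beta>_def]] by blast
      have fits_D: "fits (a i) (D (r\<^sub>2 i))" for i
      proof -
        obtain v where "C (r i) \<subseteq> hallway (a i) v"
          using subset_hallway_if_discrete_region[OF sub a(1)] .
        then show ?thesis unfolding D_r fits_translation by (rule fits_if_subset_hallway)
      qed
      show ?thesis using fits_limit[OF a(2) fits_D approx] .
    qed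
    show "dir \<beta> \<bullet> (p - q) \<le> 1" if pq: "p \<in> S" "q \<in> S" for p q
    \<comment> \<open>For \<open>\<kappa> = 0\<close> the size bound of \<open>butterfly_width\<close> degenerates, but then \<open>dir \<beta>\<close> is vertical and
      the horizontal strip gives the width.\<close>
    proof (cases "\<kappa> = 0")
      case True
      then have half_pi: "\<beta> = pi / 2" by (simp add: \<beta>_def)
      have "p \<in> horiz_strip" "q \<in> horiz_strip" using pq strip by blast+
      then show ?thesis unfolding half_pi by (simp add: dir_inner horiz_strip_iff)
    next
      case False
      then have \<beta>: "0 \<le> \<beta>" "\<beta> < pi / 2" using \<kappa> by (auto simp: \<beta>_def)
      then have cos: "cos \<beta> > 0" by (intro cos_gt_zero_pi) auto
      obtain y where y: "\<And>i. y i \<in> D (r\<^sub>2 i)" "y \<longlonglongrightarrow> p" using approx[OF pq(1)] by blast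
      obtain z where z: "\<And>i. z i \<in> D (r\<^sub>2 i)" "z \<longlonglongrightarrow> q" using approx[OF pq(2)] by blast
      let ?g\<^sub>1 = "\<lambda>i. gamma1 (N (r i)) (K (r i))" and ?g\<^sub>2 = "\<lambda>i. gamma2 (N (r i)) (K (r i))"
      have lim_l: "(\<lambda>i. dir (?g\<^sub>1 i) \<bullet> (y i - z i)) \<longlonglongrightarrow> dir \<beta> \<bullet> (p - q)"
        by (intro tendsto_intros lim_g1 y z)
      have lim_r: "(\<lambda>i. 1 + 2 * (norm (dir (?g\<^sub>1 i) - dir (?g\<^sub>2 i)) * (1 / cos (?g\<^sub>2 i) + 1)))
          \<longlonglongrightarrow> 1 + 2 * (norm (dir \<beta> - dir \<beta>) * (1 / cos \<beta> + 1))"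
        using cos by (intro tendsto_intros lim_g1 lim_g2) auto
      have ev: "\<forall>\<^sub>F i in sequentially. dir (?g\<^sub>1 i) \<bullet> (y i - z i) \<le>
          1 + 2 * (norm (dir (?g\<^sub>1 i) - dir (?g\<^sub>2 i)) * (1 / cos (?g\<^sub>2 i) + 1))"
        using order_tendstoD(2)[OF lim_g2 \<beta>(2)]
      proof eventually_elim
        case (elim i)
        obtain y' z' where y': "y' \<in> C (r i)" "y i = (- fst (x (r i)), 0) + y'"
          and z': "z' \<in> C (r i)" "z i = (- fst (x (r i)), 0) + z'"
          using y(1)[of i] z(1)[of i] unfolding D_r by blast
        have "0 \<le> ?g\<^sub>1 i" "?g\<^sub>1 i \<le> ?g\<^sub>2 i"
          using K3[of "r i"] N(2)[of "r i"] unfolding gamma1_def gamma2_def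
          by (auto intro!: mult_right_mono divide_right_mono mult_nonneg_nonneg divide_nonneg_nonneg)
        moreover have "y' \<in> horiz_strip \<inter> butterfly (?g\<^sub>1 i) (?g\<^sub>2 i)" "z' \<in> horiz_strip \<inter> butterfly (?g\<^sub>1 i) (?g\<^sub>2 i)"
          using y'(1) z'(1) sub discrete_region_subset by blast+
        ultimately have "dir (?g\<^sub>1 i) \<bullet> (y' - z') \<le>
            1 + 2 * (norm (dir (?g\<^sub>1 i) - dir (?g\<^sub>2 i)) * (1 / cos (?g\<^sub>2 i) + 1))"
          using elim by (intro butterfly_width)
        then show ?case unfolding y'(2) z'(2) by simp
      qed
      show ?thesis using tendsto_le[OF sequentially_bot lim_r lim_l ev] by simp
    qed
  qed (rule S)+
  have "c \<le> emeasure lebesgue S"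
  proof (rule le_emeasure_if_le_open_supersets)
    show "S \<in> sets lebesgue" using S(1) by (simp add: compact_imp_closed borel_closed)
    fix U assume U: "open U" "S \<subseteq> U"
    obtain i where i: "D (r\<^sub>2 i) \<subseteq> U"
      using eventually_happens'[OF sequentially_bot absorb[OF U]] by blast
    have "c \<le> emeasure lebesgue (D (r\<^sub>2 i))" unfolding D_r emeasure_translate by (rule c)
    also have "\<dots> \<le> emeasure lebesgue U" using i U(1) by (intro emeasure_mono) auto
    finally show "c \<le> emeasure lebesgue U" .
  qed
  also have "\<dots> \<le> mu_MS"
    unfolding mu_MS_def using \<open>moving_sofa S\<close> by (intro SUP_upper) simp
  finally show ?thesis .
qed

lemma less_W_obtains:
  assumes "c < W n" "n > 0"
  obtains k u C where "k \<in> {1..nat \<lceil>real n / 3\<rceil>}" "C \<in> components (discrete_region n k u)"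
    "c < emeasure lebesgue C"
proof -
  let ?G = "\<lambda>k. G_sup (angles n k) (gamma1 n k) (gamma2 n k)"
  have "W n \<in> ?G ` {1..nat \<lceil>real n / 3\<rceil>}"
    unfolding W_def using assms(2) by (intro Max_in) (auto simp: le_nat_iff one_le_ceiling)
  then obtain k where k: "k \<in> {1..nat \<lceil>real n / 3\<rceil>}" "c < ?G k" using assms(1) by auto
  then obtain u where "c < lambda_star (discrete_region n k u)"
    unfolding G_sup_eq less_SUP_iff by blast
  then obtain C where "C \<in> components (discrete_region n k u)" "c < emeasure lebesgue C"
    unfolding lambda_star_def less_SUP_iff by blast
  then show thesis using k(1) that by blast
qed

theorem theorem5: "W \<longlonglongrightarrow> mu_MS"
proof (rule order_tendstoI)
  fix a assume "a < mu_MS"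
  then have "a < W n" if "n \<ge> 3" for n using mu_MS_le_W[OF that] by (rule less_le_trans)
  then show "\<forall>\<^sub>F n in sequentially. a < W n" by (auto simp: eventually_sequentially)
next
  fix a assume "mu_MS < a"
  then obtain c where c: "mu_MS < c" "c < a" using dense by blast
  show "\<forall>\<^sub>F n in sequentially. W n < a"
  proof (rule ccontr)
    assume not: "\<not> ?thesis"
    have "\<exists>n\<ge>max 12 i. c < W n" for i
    proof -
      obtain n where "n \<ge> max 12 i" "\<not> W n < a" using not unfolding eventually_sequentially by blast
      then show ?thesis using c(2) by (metis less_le_trans not_less)
    qed
    then obtain N where N: "\<And>i. N i \<ge> max 12 i" "\<And>i. c < W (N i)" by metis
    have N12: "N i \<ge> 12" "N i > 0" "N i \<ge> i" for i using N(1)[of i] by auto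
    have "\<exists>k u C. k \<in> {1..nat \<lceil>real (N i) / 3\<rceil>} \<and> C \<in> components (discrete_region (N i) k u) \<and>
        c \<le> emeasure lebesgue C" for i
    proof -
      obtain k u C where kC: "k \<in> {1..nat \<lceil>real (N i) / 3\<rceil>}" "C \<in> components (discrete_region (N i) k u)"
        and less: "c < emeasure lebesgue C"
        using less_W_obtains[OF N(2) N12(2)] .
      show ?thesis
        by (intro exI[of _ k] exI[of _ u] exI[of _ C] conjI kC less_imp_le[OF less])
    qed
    then obtain K u C where KC: "\<And>i. K i \<in> {1..nat \<lceil>real (N i) / 3\<rceil>}"
      "\<And>i. C i \<in> components (discrete_region (N i) (K i) (u i))" "\<And>i. c \<le> emeasure lebesgue (C i)"
      by metis
    have "filterlim N at_top sequentially"
      by (rule filterlim_at_top_mono[OF filterlim_ident]) (simp add: N12(3))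
    then have "c \<le> mu_MS" using N12(1) KC by (rule le_mu_MS_if_components)
    then show False using c(1) by simp
  qed
qed

end
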